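(* Let $\mathcal{K}$ be a field, let $n\ge1$, $r\ge5$, $k\ge 1$ be integers, and let $\mathcal{R}=\mathcal{K}[\mathcal{M}]$ be the monomial ring attached to $(n,r)$ in the context. Suppose $\mathcal{R}$ is strictly $k$-Buchsbaum, and let $\widetilde{\mathcal{R}}$ be the Macaulayfication of $\mathcal{R}$ and $Q=(s^{a_n},t^{a_n})$. Then $$\operatorname{reg}(\mathcal{R})=\max\{k+2,\ r_Q(\widetilde{\mathcal{R}})\}.$$
   Context: Let $\mathcal{K}$ be a field. For integers $n\ge 1$ and $r\ge 5$ put $b_1=r$, $b_2=2r-2$ and $a_i=2r+2i-1$ for $0\le i\le n$. Let $$\mathcal{M}=\{s^{a_n},\ s^{a_n-b_1}t^{b_1},\ s^{a_n-b_2}t^{b_2},\ s^{a_n-a_0}t^{a_0},\ s^{a_n-a_1}t^{a_1},\dots,s^{a_n-a_{n-1}}t^{a_{n-1}},\ t^{a_n}\}\subset\mathcal{K}[s,t],$$ and let $\mathcal{R}=\mathcal{K}[\mathcal{M}]$ be the $\mathcal{K}$-subalgebra of $\mathcal{K}[s,t]$ generated by $\mathcal{M}$, graded by $\deg s^\alpha t^\beta=(\alpha+\beta)/a_n$, with homogeneous maximal ideal $\mathfrak{m}=(\mathcal{M})\mathcal{R}$. For $k\ge 1$, $\mathcal{R}$ is strictly $k$-Buchsbaum if $k$ is the least integer with $\mathfrak{m}^kH^1_{\mathfrak{m}}(\mathcal{R})=0$, i.e. $\mathfrak{m}^kH^1_{\mathfrak{m}}(\mathcal{R})=0$ but $\mathfrak{m}^{k-1}H^1_{\mathfrak{m}}(\mathcal{R})\neq0$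 (with $\mathfrak{m}^0=\mathcal{R}$). The Macaulayfication $\widetilde{\mathcal{R}}$ of $\mathcal{R}$ is the unique finite ring extension $\mathcal{R}\subseteq\widetilde{\mathcal{R}}$ (inside the fraction field) with $\widetilde{\mathcal{R}}$ Cohen-Macaulay and $\widetilde{\mathcal{R}}/\mathcal{R}$ of finite length; it is a monomial subring of $\mathcal{K}[s,t]$ graded by the same rule. $r_Q(\widetilde{\mathcal{R}})$ is the least nonnegative integer $m$ such that $\widetilde{\mathcal{R}}_{m+1}=(Q\widetilde{\mathcal{R}})_{m+1}$. $\operatorname{reg}(\mathcal{R})=\max\{i+j: H^i_{\mathfrak{m}}(\mathcal{R})_j\neq0\}$ is the Castelnuovo-Mumford regularity. *)

theory Defs
  imports
    "HOL-Algebra.Ideal_Product"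
    "HOL-Algebra.Generated_Rings"
    "HOL-Algebra.Ring_Divisibility"
    "HOL-Algebra.Algebraic_Closure_Type"
    "HOL-Computational_Algebra.Polynomial"
    "HOL-Computational_Algebra.Fraction_Field"
    "HOL-Library.Extended_Nat"
begin

section \<open>Cohen-Macaulay rings\<close>

definition regular_sequence :: "('a, 'b) ring_scheme \<Rightarrow> 'a list \<Rightarrow> bool" where
  "regular_sequence R xs \<longleftrightarrow>
     set xs \<subseteq> carrier R \<and>
     Idl\<^bsub>R\<^esub> (set xs) \<noteq> carrier R \<and>
     (\<forall>i < length xs. \<forall>a \<in> carrier R.
        xs ! i \<otimes>\<^bsub>R\<^esub> a \<in> Idl\<^bsub>R\<^esub> (set (take i xs)) \<longrightarrow> a \<in> Idl\<^bsub>R\<^esub> (set (take i xs)))"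

definition ideal_depth :: "('a, 'b) ring_scheme \<Rightarrow> 'a set \<Rightarrow> enat" where
  "ideal_depth R P = Sup {enat (length xs) | xs. set xs \<subseteq> P \<and> regular_sequence R xs}"

definition prime_height :: "('a, 'b) ring_scheme \<Rightarrow> 'a set \<Rightarrow> enat" where
  "prime_height R P =
     Sup {enat l | l C. (\<forall>i \<le> l. primeideal (C i) R) \<and> (\<forall>i < l. C i \<subset> C (Suc i)) \<and> C l = P}"

text \<open>The non-local definition (as in Eisenbud's \<^emph>\<open>Commutative Algebra\<close>, Section 18.2): a Noetherian
  ring in which every maximal ideal has depth equal to its height.\<close>

definition cohen_macaulay :: "('a, 'b) ring_scheme \<Rightarrow> bool" where
  "cohen_macaulay R \<longleftrightarrow>
     cring R \<and> noetherian_ring R \<and> (\<forall>P. maximalideal P R \<longrightarrow> ideal_depth R P = prime_height R P)"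

definition ideal_power :: "('a, 'b) ring_scheme \<Rightarrow> 'a set \<Rightarrow> nat \<Rightarrow> 'a set" where
  "ideal_power R I k = ((\<lambda>J. ideal_prod R I J) ^^ k) (carrier R)"


section \<open>Subrings of a field and the Macaulayfication\<close>

text \<open>All rings below are subrings of a fixed field, represented by their carrier sets.\<close>

definition ring_on :: "'f::field set \<Rightarrow> 'f ring" where
  "ring_on A = ring_of_type_algebra\<lparr>carrier := A\<rparr>"

definition fraction_subfield :: "'f::field set \<Rightarrow> 'f set" where
  "fraction_subfield A = {a / b | a b. a \<in> A \<and> b \<in> A \<and> b \<noteq> 0}"

definition finite_extension :: "'f::field set \<Rightarrow> 'f set \<Rightarrow> bool" where
  "finite_extension A B \<longleftrightarrow> A \<subseteq> B \<and>
     (\<exists>S. finite S \<and> S \<subseteq> B \<and> (\<forall>b \<in> B. \<exists>c. (\<forall>x \<in> S. c x \<in> A) \<and> b = (\<Sum>x\<in>S. c x * x)))"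

definition submodule_over :: "'f::field set \<Rightarrow> 'f set \<Rightarrow> bool" where
  "submodule_over A N \<longleftrightarrow>
     0 \<in> N \<and> (\<forall>u \<in> N. \<forall>v \<in> N. u + v \<in> N) \<and> (\<forall>a \<in> A. \<forall>u \<in> N. a * u \<in> N)"

text \<open>\<open>M / N\<close> has a composition series as an \<open>A\<close>-module; its members are represented by their
  preimages in \<open>M\<close>.\<close>

definition finite_length_quotient :: "'f::field set \<Rightarrow> 'f set \<Rightarrow> 'f set \<Rightarrow> bool" where
  "finite_length_quotient A M N \<longleftrightarrow>
     (\<exists>(l::nat) C. C 0 = N \<and> C l = M \<and>
        (\<forall>i \<le> l. submodule_over A (C i)) \<and>
        (\<forall>i < l. C i \<subset> C (Suc i) \<and> (\<nexists>L. submodule_over A L \<and> C i \<subset> L \<and> L \<subset> C (Suc i))))"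

definition is_macaulayfication :: "'f::field set \<Rightarrow> 'f set \<Rightarrow> bool" where
  "is_macaulayfication A B \<longleftrightarrow>
     subring B ring_of_type_algebra \<and>
     B \<subseteq> fraction_subfield A \<and>
     finite_extension A B \<and>
     cohen_macaulay (ring_on B) \<and>
     finite_length_quotient A B A"


section \<open>Local cohomology and regularity\<close>

text \<open>Local cohomology of a domain \<open>A\<close> with support in the ideal generated by the nonzero elements
  \<open>xs\<close> is the cohomology of the Cech complex of \<open>A\<close> on \<open>xs\<close>. Its term in degree \<open>p\<close> is the direct
  sum, over the \<open>p\<close>-element sets \<open>I\<close> of indices, of the localization of \<open>A\<close> at the product of the
  \<open>xs ! i\<close> with \<open>i \<in> I\<close>; all these localizations lie in the ambient field. A cochain is a function
  on sets of indices that is \<open>0\<close> outside the \<open>p\<close>-element ones.\<close>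

definition localization_at :: "'f::field set \<Rightarrow> 'f \<Rightarrow> 'f set" where
  "localization_at A x = {a / x ^ N | a (N::nat). a \<in> A}"

definition cech_cochains :: "'f::field set \<Rightarrow> 'f list \<Rightarrow> nat \<Rightarrow> (nat set \<Rightarrow> 'f) set" where
  "cech_cochains A xs p =
     {c. \<forall>I. if I \<subseteq> {..<length xs} \<and> card I = p
             then c I \<in> localization_at A (\<Prod>i\<in>I. xs ! i) else c I = 0}"

definition cech_diff :: "'f::field list \<Rightarrow> (nat set \<Rightarrow> 'f) \<Rightarrow> (nat set \<Rightarrow> 'f)" where
  "cech_diff xs c =
     (\<lambda>J. if J \<subseteq> {..<length xs}
          then (\<Sum>j\<in>J. (-1) ^ card {i \<in> J. i < j} * c (J - {j})) else 0)"

definition cech_cocycles :: "'f::field set \<Rightarrow> 'f list \<Rightarrow> nat \<Rightarrow> (nat set \<Rightarrow> 'f) set" where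
  "cech_cocycles A xs p = {c \<in> cech_cochains A xs p. cech_diff xs c = (\<lambda>_. 0)}"

definition cech_coboundaries :: "'f::field set \<Rightarrow> 'f list \<Rightarrow> nat \<Rightarrow> (nat set \<Rightarrow> 'f) set" where
  "cech_coboundaries A xs p =
     (case p of 0 \<Rightarrow> {\<lambda>_. 0} | Suc q \<Rightarrow> cech_diff xs ` cech_cochains A xs q)"

definition cohomology_class ::
    "'f::field set \<Rightarrow> 'f list \<Rightarrow> nat \<Rightarrow> (nat set \<Rightarrow> 'f) \<Rightarrow> (nat set \<Rightarrow> 'f) set" where
  "cohomology_class A xs p c =
     {c' \<in> cech_cocycles A xs p. (\<lambda>I. c' I - c I) \<in> cech_coboundaries A xs p}"

definition local_cohomology ::
    "'f::field set \<Rightarrow> 'f list \<Rightarrow> nat \<Rightarrow> (nat set \<Rightarrow> 'f) set set" where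
  "local_cohomology A xs p = cohomology_class A xs p ` cech_cocycles A xs p"

text \<open>For a family \<open>gr\<close> of homogeneous parts of the ambient field, the component of degree \<open>j\<close>
  consists of the classes of the cocycles with all values homogeneous of degree \<open>j\<close>.\<close>

definition local_cohomology_deg ::
    "(int \<Rightarrow> 'f::field set) \<Rightarrow> 'f set \<Rightarrow> 'f list \<Rightarrow> nat \<Rightarrow> int \<Rightarrow> (nat set \<Rightarrow> 'f) set set" where
  "local_cohomology_deg gr A xs p j =
     cohomology_class A xs p ` {c \<in> cech_cocycles A xs p. \<forall>I. c I \<in> gr j}"

definition annihilates_local_cohomology ::
    "'f::field set \<Rightarrow> 'f set \<Rightarrow> 'f list \<Rightarrow> nat \<Rightarrow> bool" where
  "annihilates_local_cohomology J A xs p \<longleftrightarrow>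
     (\<forall>a \<in> J. \<forall>c \<in> cech_cocycles A xs p.
        cohomology_class A xs p (\<lambda>I. a * c I) = cohomology_class A xs p (\<lambda>_. 0))"

definition regularity :: "(int \<Rightarrow> 'f::field set) \<Rightarrow> 'f set \<Rightarrow> 'f list \<Rightarrow> int" where
  "regularity gr A xs =
     (GREATEST d. \<exists>p j. d = int p + j \<and>
        local_cohomology_deg gr A xs p j \<noteq> {cohomology_class A xs p (\<lambda>_. 0)})"

text \<open>Here \<open>xs\<close> generates the ideal \<open>\<mm>\<close>.\<close>

definition strictly_buchsbaum :: "nat \<Rightarrow> 'f::field set \<Rightarrow> 'f list \<Rightarrow> bool" where
  "strictly_buchsbaum k A xs \<longleftrightarrow>
     (let \<mm> = Idl\<^bsub>ring_on A\<^esub> (set xs) in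
        annihilates_local_cohomology (ideal_power (ring_on A) \<mm> k) A xs 1 \<and>
        \<not> annihilates_local_cohomology (ideal_power (ring_on A) \<mm> (k - 1)) A xs 1)"

definition reduction_number :: "(int \<Rightarrow> 'f::field set) \<Rightarrow> 'f set \<Rightarrow> 'f set \<Rightarrow> nat" where
  "reduction_number gr Q B =
     (LEAST m. B \<inter> gr (int m + 1) = (Idl\<^bsub>ring_on B\<^esub> Q) \<inter> gr (int m + 1))"


section \<open>The monomial rings\<close>

text \<open>The ambient field is the fraction field of \<open>K[s,t] = K[s][t]\<close>: the inner polynomial variable
  is \<open>s\<close>, the outer one is \<open>t\<close>.\<close>

definition const_st :: "'k::field \<Rightarrow> 'k poly poly fract" where
  "const_st c = Fraction_Field.Fract [:[:c:]:] 1"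

definition monom_st :: "nat \<Rightarrow> nat \<Rightarrow> 'k::field poly poly fract" where
  "monom_st i j = Fraction_Field.Fract (Polynomial.monom (Polynomial.monom 1 i) j) 1"

definition homogeneous_st :: "nat \<Rightarrow> 'k::field poly poly \<Rightarrow> bool" where
  "homogeneous_st d p \<longleftrightarrow>
     (\<forall>i j. Polynomial.coeff (Polynomial.coeff p j) i \<noteq> 0 \<longrightarrow> i + j = d)"

text \<open>Quotients of homogeneous polynomials whose degrees \<open>\<alpha> + \<beta>\<close> differ by \<open>d\<close>.\<close>

definition homogeneous_part :: "int \<Rightarrow> 'k::field poly poly fract set" where
  "homogeneous_part d =
     {Fraction_Field.Fract p q | p q e e'.
        q \<noteq> 0 \<and> homogeneous_st e q \<and> homogeneous_st e' p \<and> int e' = int e + d}"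

definition b1 :: "nat \<Rightarrow> nat" where "b1 r = r"

definition b2 :: "nat \<Rightarrow> nat" where "b2 r = 2 * r - 2"

definition a_exp :: "nat \<Rightarrow> nat \<Rightarrow> nat" where "a_exp r i = 2 * r + 2 * i - 1"

definition gens :: "nat \<Rightarrow> nat \<Rightarrow> 'k::field poly poly fract list" where
  "gens n r =
     [monom_st (a_exp r n) 0,
      monom_st (a_exp r n - b1 r) (b1 r),
      monom_st (a_exp r n - b2 r) (b2 r)]
     @ map (\<lambda>i. monom_st (a_exp r n - a_exp r i) (a_exp r i)) [0..<n]
     @ [monom_st 0 (a_exp r n)]"

definition monomial_ring :: "nat \<Rightarrow> nat \<Rightarrow> 'k::field poly poly fract set" where
  "monomial_ring n r = generate_ring ring_of_type_algebra (range const_st \<union> set (gens n r))"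

text \<open>The grading \<open>deg s\<^sup>\<alpha>t\<^sup>\<beta> = (\<alpha> + \<beta>) / a\<^sub>n\<close>.\<close>

definition grading :: "nat \<Rightarrow> nat \<Rightarrow> int \<Rightarrow> 'k::field poly poly fract set" where
  "grading n r j = homogeneous_part (j * int (a_exp r n))"

definition Q_gens :: "nat \<Rightarrow> nat \<Rightarrow> 'k::field poly poly fract set" where
  "Q_gens n r = {monom_st (a_exp r n) 0, monom_st 0 (a_exp r n)}"

end

theory Submission
  imports Defs "HOL-Library.Product_Plus"
begin

text \<open>
  Let \<open>D = a\<^sub>n\<close> and let \<open>S\<close> be the semigroup of exponents \<open>(a, b)\<close> of the monomials of \<open>\<R>\<close>, so that
  \<open>\<R> = K[S]\<close>; its group is \<open>G = {(a, b). D dvd a + b}\<close>. Inverting \<open>s\<^sup>D\<close> leaves the condition that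
  \<open>b\<close> lies in the numerical semigroup \<open>\<Gamma>\<^sub>t\<close> of exponents of \<open>t\<close>, inverting \<open>t\<^sup>D\<close> leaves the condition
  that \<open>a\<close> lies in the numerical semigroup \<open>\<Gamma>\<^sub>s\<close> generated by \<open>2\<close> and \<open>2n + 1\<close>, and inverting any
  other product of generators gives all of \<open>K[G]\<close>. Write \<open>L\<^sub>X\<close>, \<open>L\<^sub>Y\<close> for the first two exponent sets
  and \<open>S' = L\<^sub>X \<inter> L\<^sub>Y\<close>. The Cech complex on all generators then has only two cohomology groups:
  \<open>H\<^sup>1 = K[S'] / K[S]\<close> and \<open>H\<^sup>2 = K[G] / (K[L\<^sub>X] + K[L\<^sub>Y])\<close>. All other degrees are contracted by
  adding the index \<open>0\<close> to a set of indices.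

  The heart of the matter is the shape of \<open>S' - S\<close> (lemma \<open>saturation_cases\<close>): its elements all lie
  on the single ray \<open>exceptional j = (r + 4n - 2, 3r + jD)\<close>, where \<open>exceptional j\<close> has degree
  \<open>j + 2\<close>, and the \<open>j\<close> with \<open>exceptional j \<notin> S\<close> form an initial segment. Hence \<open>\<mm>\<^sup>i\<close> kills
  \<open>H\<^sup>1\<close> iff \<open>exceptional i \<in> S\<close> (lemma \<open>annihilation_iff\<close>); so \<open>\<R>\<close> is strictly \<open>k\<close>-Buchsbaum
  iff this segment is \<open>{0, \<dots>, k - 1}\<close>, and the top degree of \<open>H\<^sup>1\<close> is \<open>k + 1\<close>.

  That \<open>exceptional k\<close> is a sum of \<open>k + 2\<close> generators forces \<open>r + 4n - 2 \<le> (k + 2)(2n + 1)\<close>. This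
  is precisely the estimate that makes \<open>\<Gamma>\<^sub>t\<close> contain every integer from \<open>(2r - 2)(k + 1)\<close> on, and so
  places every point of \<open>G\<close> of degree at least \<open>k + 1\<close> in \<open>L\<^sub>X \<union> L\<^sub>Y\<close> (lemma
  \<open>points_of_high_degree\<close>). Two consequences follow. First, \<open>H\<^sup>2\<close> vanishes in degrees above \<open>k\<close>, so
  the regularity equals \<open>k + 2\<close>. Secondly, a point of \<open>S'\<close> of degree \<open>k + 3\<close> remains in \<open>S'\<close> after
  subtracting \<open>(D, 0)\<close> or \<open>(0, D)\<close>, and what remains, of degree \<open>k + 2\<close>, is already in \<open>S\<close>. Since a
  homogeneous element of the Macaulayfication is \<open>K\<close>-spanned by monomials with exponents in \<open>S'\<close>
  (lemma \<open>homogeneous_torsion\<close>, by the finite length of the quotient), the reduction number is at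
  most \<open>k + 2\<close>. So both sides of the claimed equation are \<open>k + 2\<close>.
\<close>


section \<open>The numerical semigroups and their exceptional points\<close>

locale two_parameters =
  fixes n r :: nat
  assumes n_ge_1: "n \<ge> 1" and r_ge_5: "r \<ge> 5"
begin

definition D :: int where "D = 2 * int r + 2 * int n - 1"

definition E :: "int set" where
  "E = {0, int r, 2 * int r - 2} \<union> {2 * int r + 2 * i - 1 |i. 0 \<le> i \<and> i \<le> int n}"

text \<open>
  Since \<open>0 \<in> E\<close>, this is the set of sums of at most \<open>d\<close> nonzero generators: exactly the exponents of
  \<open>t\<close> that occur in degree \<open>d\<close> of the monomial ring.
\<close>

primrec sumset :: "nat \<Rightarrow> int set" where
  "sumset 0 = {0}"
| "sumset (Suc d) = {e + x |e x. e \<in> E \<and> x \<in> sumset d}"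

definition \<Gamma>\<^sub>t :: "int set" where "\<Gamma>\<^sub>t = (\<Union>d. sumset d)"

text \<open>
  The exponents of \<open>s\<close> in the generators are \<open>D - e\<close> with \<open>e \<in> E\<close>. Among them are \<open>2\<close> and \<open>2n + 1\<close>,
  and these two already generate all the others.
\<close>

definition \<Gamma>\<^sub>s :: "int set" where "\<Gamma>\<^sub>s = {a. a \<ge> 0 \<and> (even a \<or> a \<ge> 2 * int n + 1)}"

lemma n_pos: "int n \<ge> 1" and r_bound: "int r \<ge> 5"
  using n_ge_1 r_ge_5 by auto

lemma D_pos: "D > 0"
  using n_pos r_bound by (simp add: D_def)

lemma E_basic: "0 \<in> E" "int r \<in> E" "2 * int r - 2 \<in> E" "D \<in> E"
  using n_pos by (auto simp: E_def D_def)

lemma E_odd: "odd x \<Longrightarrow> 2 * int r - 1 \<le> x \<Longrightarrow> x \<le> D \<Longrightarrow> x \<in> E"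
  unfolding E_def D_def by (auto elim!: oddE intro!: exI[of _ "_ - int r + 1"])

lemma E_cases:
  assumes "e \<in> E"
  obtains "e = 0" | "e = int r" | "e = 2 * int r - 2" | "odd e" "2 * int r - 1 \<le> e" "e \<le> D"
proof -
  consider "e = 0" | "e = int r" | "e = 2 * int r - 2"
    | i where "e = 2 * int r + 2 * i - 1" "0 \<le> i" "i \<le> int n"
    using assms unfolding E_def by blast
  then show ?thesis
    using that by cases (auto simp: D_def)
qed

lemma sumset_SucI: "e \<in> E \<Longrightarrow> x \<in> sumset d \<Longrightarrow> e + x \<in> sumset (Suc d)"
  by auto

lemma sumset_SucE:
  assumes "b \<in> sumset (Suc d)"
  obtains e x where "e \<in> E" "x \<in> sumset d" "b = e + x"
  using assms by auto

declare sumset.simps(2) [simp del]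

lemma sumset_add: "x \<in> sumset d \<Longrightarrow> y \<in> sumset d' \<Longrightarrow> x + y \<in> sumset (d + d')"
proof (induction d arbitrary: x)
  case (Suc d)
  then obtain e z where "e \<in> E" "z \<in> sumset d" "x = e + z" by (auto elim: sumset_SucE)
  then show ?case using Suc.IH[of z] Suc.prems(2) sumset_SucI[of e "z + y"] by (simp add: add.assoc)
qed simp

lemma sumset_1: "e \<in> E \<Longrightarrow> e \<in> sumset 1"
  using sumset_SucI[of e 0 0] by simp

lemma sumset_2: "e \<in> E \<Longrightarrow> e' \<in> E \<Longrightarrow> e + e' \<in> sumset 2"
  using sumset_add[of e 1 e' 1] sumset_1 by (simp add: numeral_2_eq_2)

lemma sumset_Suc_subset: "sumset d \<subseteq> sumset (Suc d)"
  using sumset_SucI[OF E_basic(1)] by auto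

lemma sumset_mono: "d \<le> d' \<Longrightarrow> sumset d \<subseteq> sumset d'"
  by (rule lift_Suc_mono_le[of sumset]) (use sumset_Suc_subset in auto)

lemma sumset_D: "int d * D \<in> sumset d"
proof (induction d)
  case (Suc d)
  then show ?case using sumset_SucI[OF E_basic(4) Suc] by (simp add: distrib_right)
qed simp

lemma \<Gamma>\<^sub>t_add: "x \<in> \<Gamma>\<^sub>t \<Longrightarrow> y \<in> \<Gamma>\<^sub>t \<Longrightarrow> x + y \<in> \<Gamma>\<^sub>t"
  unfolding \<Gamma>\<^sub>t_def using sumset_add by blast

lemma E_subset_\<Gamma>\<^sub>t: "E \<subseteq> \<Gamma>\<^sub>t"
  unfolding \<Gamma>\<^sub>t_def using sumset_1 by blast

lemma \<Gamma>\<^sub>s_add: "x \<in> \<Gamma>\<^sub>s \<Longrightarrow> y \<in> \<Gamma>\<^sub>s \<Longrightarrow> x + y \<in> \<Gamma>\<^sub>s"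
  by (auto simp: \<Gamma>\<^sub>s_def)

lemma E_bounds: "e \<in> E \<Longrightarrow> 0 \<le> e" "e \<in> E \<Longrightarrow> e \<le> D"
  using n_pos r_bound by (auto elim!: E_cases simp: D_def)

lemma E_complement: "e \<in> E \<Longrightarrow> D - e \<in> \<Gamma>\<^sub>s"
  using n_pos r_bound by (auto elim!: E_cases simp: D_def \<Gamma>\<^sub>s_def)

lemma sumset_complement: "b \<in> sumset d \<Longrightarrow> int d * D - b \<in> \<Gamma>\<^sub>s"
proof (induction d arbitrary: b)
  case (Suc d)
  then obtain e z where *: "e \<in> E" "z \<in> sumset d" "b = e + z" by (auto elim: sumset_SucE)
  have "int (Suc d) * D - b = (D - e) + (int d * D - z)"
    using * by (simp add: algebra_simps)
  then show ?case using * \<Gamma>\<^sub>s_add E_complement Suc.IH by metis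
qed (simp add: \<Gamma>\<^sub>s_def)

lemma sumset_nonneg: "b \<in> sumset d \<Longrightarrow> b \<ge> 0"
  by (induction d arbitrary: b) (auto elim!: sumset_SucE dest: E_bounds)

text \<open>
  A converse to \<open>sumset_complement\<close>: the generators \<open>0, 2, 4, \<dots>, 2n, 2n + 1\<close> of \<open>\<Gamma>\<^sub>s\<close> reach every
  element \<open>v\<close> of \<open>\<Gamma>\<^sub>s\<close> in the least number of steps that its size permits. One summand at a time is
  split off: \<open>2n + 1\<close> if \<open>v\<close> is odd, and usually \<open>2n\<close> if \<open>v\<close> is even.
\<close>

lemma complement_in_sumset:
  assumes "v \<in> \<Gamma>\<^sub>s" "v \<le> int m * (2 * int n + 1)"
  shows "int m * D - v \<in> sumset m"
  using assms
proof (induction m arbitrary: v)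
  case 0
  then show ?case by (auto simp: \<Gamma>\<^sub>s_def)
next
  case (Suc m)
  have step: "int (Suc m) * D - v \<in> sumset (Suc m)"
    if "D - w \<in> E" "v - w \<in> \<Gamma>\<^sub>s" "v - w \<le> int m * (2 * int n + 1)" for w
  proof -
    have "int (Suc m) * D - v = (D - w) + (int m * D - (v - w))"
      by (simp add: algebra_simps)
    then show ?thesis using sumset_SucI[OF that(1) Suc.IH[OF that(2,3)]] by metis
  qed
  have low: "D - w \<in> E" if "even w" "0 \<le> w" "w \<le> 2 * int n" for w
    using that by (intro E_odd) (auto simp: D_def)
  have top: "D - (2 * int n + 1) \<in> E"
    using E_basic(3) by (simp add: D_def)
  have bound: "v \<le> int m * (2 * int n + 1) + (2 * int n + 1)"
    using Suc.prems(2) by (simp add: algebra_simps)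
  have m0: "0 \<le> int m * (2 * int n + 1)" by simp
  consider "odd v" | "even v" "v \<le> 2 * int n" | "even v" "v > 2 * int n" "v - 2 * int n \<le> int m * (2 * int n + 1)"
    | "even v" "v = int m * (2 * int n + 1) + (2 * int n + 1)"
    using bound by linarith
  then show ?case
  proof cases
    case 1
    then show ?thesis using Suc.prems(1) bound
      by (intro step[OF top]) (auto simp: \<Gamma>\<^sub>s_def)
  next
    case 2
    then show ?thesis using Suc.prems(1) m0
      by (intro step[OF low[of v]]) (auto simp: \<Gamma>\<^sub>s_def)
  next
    case 3
    then show ?thesis
      by (intro step[OF low[of "2 * int n"]]) (auto simp: \<Gamma>\<^sub>s_def)
  next
    case 4
    have "m \<noteq> 0" using 4 by (intro notI) simp
    then have "int m * (2 * int n + 1) \<ge> 1 * (2 * int n + 1)"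
      by (intro mult_right_mono) auto
    then show ?thesis using 4
      by (intro step[OF top]) (auto simp: \<Gamma>\<^sub>s_def)
  qed
qed


definition G :: "(int \<times> int) set" where "G = {(a, b). D dvd a + b}"

definition L\<^sub>X :: "(int \<times> int) set" where "L\<^sub>X = {(a, b). D dvd a + b \<and> b \<in> \<Gamma>\<^sub>t}"

definition L\<^sub>Y :: "(int \<times> int) set" where "L\<^sub>Y = {(a, b). D dvd a + b \<and> a \<in> \<Gamma>\<^sub>s}"

text \<open>
  As all generators have degree one, the monomials with these exponents span the \<open>i\<close>-th power of the
  homogeneous maximal ideal.
\<close>

definition S_ge :: "nat \<Rightarrow> (int \<times> int) set" where
  "S_ge i = {(a, b). \<exists>d\<ge>i. a + b = int d * D \<and> b \<in> sumset d}"

abbreviation S :: "(int \<times> int) set" where "S \<equiv> S_ge 0"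

text \<open>
  An abstraction of the sums of \<open>m\<close> generators, all different from \<open>0\<close> and \<open>r\<close>. The last conjunct is
  what such a sum offers to a preceding \<open>r + r\<close>: unless all summands equal \<open>D\<close>, three summands can be
  traded for two (lemma \<open>two_r_plus\<close>).
\<close>

definition heavy :: "nat \<Rightarrow> int \<Rightarrow> bool" where
  "heavy m x \<longleftrightarrow> x \<in> sumset m \<and> int m * (2 * int r - 2) \<le> x \<and>
     (x = int m * D \<or> 2 * int r + x \<in> sumset (Suc m))"

text \<open>
  \<open>2r + (2r - 2) = (2r - 1) + (2r - 1)\<close>, and \<open>2r + e = (2r - 2) + (e + 2)\<close> for odd \<open>e < D\<close>.
\<close>

lemma two_r_plus:
  assumes "e \<in> E" "e \<noteq> 0" "e \<noteq> int r" "e \<noteq> D"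
  shows "2 * int r + e \<in> sumset 2"
  using assms(1)
proof (cases rule: E_cases)
  case 3
  have "2 * int r - 1 \<in> E" using n_pos by (intro E_odd) (auto simp: D_def)
  then have "(2 * int r - 1) + (2 * int r - 1) \<in> sumset 2" by (intro sumset_2)
  moreover have "(2 * int r - 1) + (2 * int r - 1) = 2 * int r + e" using 3 by simp
  ultimately show ?thesis by metis
next
  case 4
  then have "e + 2 \<in> E" using assms(4) by (intro E_odd) (auto simp: D_def, presburger)
  then show ?thesis using sumset_2[OF E_basic(3), of "e + 2"] by (simp add: algebra_simps)
qed (use assms in auto)

lemma heavy_step:
  assumes "heavy m x" "e \<in> E" "e \<noteq> 0" "e \<noteq> int r"
  shows "heavy (Suc m) (e + x)"
proof -
  have "e \<ge> 2 * int r - 2"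
    using assms(2-4) by (auto elim: E_cases)
  then have "int (Suc m) * (2 * int r - 2) \<le> e + x"
    using assms(1) by (simp add: heavy_def algebra_simps)
  moreover have "e + x = int (Suc m) * D \<or> 2 * int r + (e + x) \<in> sumset (Suc (Suc m))"
  proof (cases "e = D")
    case True
    then show ?thesis
      using assms(1) sumset_SucI[OF assms(2), of "2 * int r + x" "Suc m"]
      by (auto simp: heavy_def algebra_simps)
  next
    case False
    have "(2 * int r + e) + x \<in> sumset (2 + m)"
      using assms(1) two_r_plus[OF assms(2-4) False] by (intro sumset_add) (auto simp: heavy_def)
    then show ?thesis by (simp add: algebra_simps)
  qed
  ultimately show ?thesis
    using assms(1) sumset_SucI[OF assms(2)] unfolding heavy_def by blast
qed

text \<open>
  Unless a summand can be saved, a sum of \<open>d\<close> generators contains \<open>r\<close> at most three times, and two or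
  three copies of \<open>r\<close> are accompanied by copies of \<open>D\<close> only. Indeed \<open>4r = (2r - 1) + (2r + 1)\<close>, and
  \<open>two_r_plus\<close> absorbs two copies of \<open>r\<close> as soon as another generator is present.
\<close>

lemma sumset_normal_form:
  assumes "b \<in> sumset d"
  shows "(\<exists>m. d = Suc m \<and> b \<in> sumset m) \<or> heavy d b \<or> (\<exists>m. d = Suc m \<and> heavy m (b - int r)) \<or>
    (\<exists>m. d = m + 2 \<and> b = 2 * int r + int m * D) \<or> (\<exists>m. d = m + 3 \<and> b = 3 * int r + int m * D)"
  using assms
proof (induction d arbitrary: b)
  case 0
  then show ?case by (simp add: heavy_def)
next
  case (Suc d)
  obtain e x where e: "e \<in> E" and x: "x \<in> sumset d" and b: "b = e + x"
    using Suc.prems by (auto elim: sumset_SucE)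
  have fewer: ?case if "b \<in> sumset d" using that by blast
  consider "e = 0" | "e = int r" | "e = D" | "e \<noteq> 0" "e \<noteq> int r" "e \<noteq> D" by blast
  then show ?case
  proof cases
    case 1
    then show ?thesis using x b fewer by simp
  next
    case 2
    consider m where "d = Suc m" "x \<in> sumset m" | "heavy d x" | m where "d = Suc m" "heavy m (x - int r)"
      | m where "d = m + 2" "x = 2 * int r + int m * D" | m where "d = m + 3" "x = 3 * int r + int m * D"
      using Suc.IH[OF x] by blast
    then show ?thesis
    proof cases
      case 1
      then show ?thesis using b sumset_SucI[OF e] fewer by blast
    next
      case 22: 2
      then have "heavy d (b - int r)" using b 2 by simp
      then show ?thesis by blast
    next
      case (3 m)
      then have "x - int r = int m * D \<or> 2 * int r + (x - int r) \<in> sumset d"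
        unfolding heavy_def by blast
      moreover have "b = 2 * int r + (x - int r)" using b 2 by simp
      ultimately show ?thesis using 3(1) fewer by auto
    next
      case (4 m)
      then have "Suc d = m + 3 \<and> b = 3 * int r + int m * D" using b 2 by simp
      then show ?thesis by blast
    next
      case (5 m)
      have "2 * int r - 1 \<in> E" "2 * int r + 1 \<in> E"
        using n_pos by (auto intro!: E_odd simp: D_def)
      then have "(2 * int r - 1) + (2 * int r + 1) + int m * D \<in> sumset (2 + m)"
        by (intro sumset_add sumset_2 sumset_D)
      then have "b \<in> sumset (2 + m)" using b 2 5 by (simp add: algebra_simps)
      then have "b \<in> sumset d" using sumset_mono[of "2 + m" d] 5 by auto
      then show ?thesis by (rule fewer)
    qed
  next
    case 3
    have e': "e \<noteq> 0" "e \<noteq> int r" using 3 D_pos r_bound n_pos by (auto simp: D_def)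
    consider m where "d = Suc m" "x \<in> sumset m" | "heavy d x" | m where "d = Suc m" "heavy m (x - int r)"
      | m where "d = m + 2" "x = 2 * int r + int m * D" | m where "d = m + 3" "x = 3 * int r + int m * D"
      using Suc.IH[OF x] by blast
    then show ?thesis
    proof cases
      case 1
      then show ?thesis using b sumset_SucI[OF e] fewer by blast
    next
      case 2
      then show ?thesis using b heavy_step[OF _ e e'] by blast
    next
      case (3 m)
      then have "heavy d (b - int r)" using b heavy_step[OF 3(2) e e'] by (simp add: algebra_simps)
      then show ?thesis by blast
    next
      case (4 m)
      then have "Suc d = Suc m + 2 \<and> b = 2 * int r + int (Suc m) * D" using b 3 by (simp add: algebra_simps)
      then show ?thesis by blast
    next
      case (5 m)
      then have "Suc d = Suc m + 3 \<and> b = 3 * int r + int (Suc m) * D" using b 3 by (simp add: algebra_simps)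
      then show ?thesis by blast
    qed
  next
    case 4
    note e' = 4(1,2)
    consider m where "d = Suc m" "x \<in> sumset m" | "heavy d x" | m where "d = Suc m" "heavy m (x - int r)"
      | m where "d = m + 2" "x = 2 * int r + int m * D" | m where "d = m + 3" "x = 3 * int r + int m * D"
      using Suc.IH[OF x] by blast
    then show ?thesis
    proof cases
      case 1
      then show ?thesis using b sumset_SucI[OF e] fewer by blast
    next
      case 2
      then show ?thesis using b heavy_step[OF _ e e'] by blast
    next
      case (3 m)
      then have "heavy d (b - int r)" using b heavy_step[OF 3(2) e e'] by (simp add: algebra_simps)
      then show ?thesis by blast
    next
      case (5 m)
      have "int r + ((2 * int r + e) + int m * D) \<in> sumset (Suc (2 + m))"
        by (intro sumset_SucI sumset_add two_r_plus e 4 sumset_D E_basic)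
      moreover have "Suc (2 + m) = d" using 5 by simp
      moreover have "int r + ((2 * int r + e) + int m * D) = b" using b 5 by simp
      ultimately show ?thesis using fewer by metis
    next
      case 44: (4 m)
      have "(2 * int r + e) + int m * D \<in> sumset (2 + m)"
        by (intro sumset_add two_r_plus e 4 sumset_D)
      then show ?thesis using b 44 fewer by (simp add: algebra_simps)
    qed
  qed
qed

text \<open>
  The last alternative of the normal form is the only obstruction to saving a summand: if \<open>r\<close> occurs
  at most once, \<open>dD - b\<close> is small enough for \<open>complement_in_sumset\<close>, and if two copies of \<open>r\<close> are
  accompanied by copies of \<open>D\<close>, then \<open>dD - b = 2n - 1\<close> is not in \<open>\<Gamma>\<^sub>s\<close>.
\<close>

lemma drop_summand:
  assumes "b \<in> sumset (Suc d)" "int d * D - b \<in> \<Gamma>\<^sub>s"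
  shows "b \<in> sumset d \<or> (\<exists>j. d = j + 2 \<and> b = 3 * int r + int j * D)"
proof -
  have small: "b \<in> sumset d" if "int (Suc d) * (2 * int r - 2) - int r \<le> b"
  proof -
    have "int d * D - b \<le> int d * (2 * int n + 1)"
      using that r_bound by (simp add: D_def algebra_simps)
    from complement_in_sumset[OF assms(2) this] show ?thesis by simp
  qed
  consider m where "Suc d = Suc m" "b \<in> sumset m" | "heavy (Suc d) b"
    | m where "Suc d = Suc m" "heavy m (b - int r)"
    | m where "Suc d = m + 2" "b = 2 * int r + int m * D"
    | m where "Suc d = m + 3" "b = 3 * int r + int m * D"
    using sumset_normal_form[OF assms(1)] by blast
  then show ?thesis
  proof cases
    case 1
    then show ?thesis by simp
  next
    case 2
    then show ?thesis using small by (simp add: heavy_def)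
  next
    case (3 m)
    then show ?thesis using small by (simp add: heavy_def algebra_simps)
  next
    case (4 m)
    then have "d = Suc m" by simp
    then have "int d * D - b = 2 * int n - 1"
      using 4(2) by (simp add: D_def algebra_simps)
    then show ?thesis using assms(2) by (auto simp: \<Gamma>\<^sub>s_def)
  next
    case (5 m)
    then show ?thesis by simp
  qed
qed

text \<open>
  Write \<open>b\<close> as a sum of sufficiently many generators and remove surplus summands one by one with
  \<open>drop_summand\<close>. The process stops early only at an exceptional point. An obstruction met strictly
  above the degree of \<open>(a, b)\<close> means \<open>a = 2n - 1 - r\<close>; then \<open>3r = D - a\<close> is itself a generator, and
  \<open>(a, b)\<close> lies in \<open>S\<close> after all.
\<close>

lemma saturation_cases:
  assumes "(a, b) \<in> L\<^sub>X \<inter> L\<^sub>Y"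
  shows "(a, b) \<in> S \<or> (\<exists>j. a = int r + 4 * int n - 2 \<and> b = 3 * int r + int j * D)"
proof -
  have claim: "(a, b) \<in> S \<or> (\<exists>j. a = int r + 4 * int n - 2 \<and> b = 3 * int r + int j * D)"
    if "b \<in> sumset (q + m)" "a + b = int q * D" "a \<in> \<Gamma>\<^sub>s" for q m
    using that
  proof (induction m)
    case 0
    then show ?case by (auto simp: S_ge_def)
  next
    case (Suc m)
    have am: "int (q + m) * D - b = a + int m * D"
      using Suc.prems(2) by (simp add: algebra_simps)
    also have "\<dots> \<in> \<Gamma>\<^sub>s"
      using sumset_complement[of 0 m] Suc.prems(3) \<Gamma>\<^sub>s_add sumset_mono[of 0 m] by auto
    finally consider "b \<in> sumset (q + m)" | j where "q + m = j + 2" "b = 3 * int r + int j * D"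
      using drop_summand[of b "q + m"] Suc.prems(1) by auto
    then show ?case
    proof cases
      case 1
      then show ?thesis using Suc by blast
    next
      case (2 j)
      have a: "a + int m * D = int r + 4 * int n - 2"
        using am 2 by (simp add: D_def algebra_simps flip: of_nat_add)
      have "a \<ge> 0" using Suc.prems(3) by (simp add: \<Gamma>\<^sub>s_def)
      \<comment> \<open>twice \<open>D\<close> exceeds \<open>r + 4n - 2\<close>\<close>
      have "m < 2"
      proof (rule ccontr)
        assume "\<not> m < 2"
        then have "2 * D \<le> int m * D" using D_pos by (intro mult_right_mono) auto
        then show False using a \<open>a \<ge> 0\<close> r_bound by (simp add: D_def)
      qed
      then consider "m = 0" | "m = 1" by linarith
      then show ?thesis
      proof cases
        case 1
        then show ?thesis using a 2 by auto
      next
        case m1: 2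
        have a': "a = 2 * int n - 1 - int r" using a m1 by (simp add: D_def)
        then have "even a" using Suc.prems(3) r_bound by (auto simp: \<Gamma>\<^sub>s_def)
        then have "3 * int r \<in> E" using a' \<open>a \<ge> 0\<close> by (intro E_odd) (auto simp: D_def)
        then have "b \<in> sumset (Suc j)" using 2 sumset_SucI sumset_D by blast
        moreover have "q = Suc j" using 2(1) m1 by simp
        ultimately have "(a, b) \<in> S" using Suc.prems(2) unfolding S_ge_def by blast
        then show ?thesis by blast
      qed
    qed
  qed
  obtain d where d: "b \<in> sumset d" using assms by (auto simp: L\<^sub>X_def \<Gamma>\<^sub>t_def)
  have as: "a \<in> \<Gamma>\<^sub>s" and "D dvd a + b" using assms by (auto simp: L\<^sub>Y_def)
  then obtain z where z: "a + b = D * z" by (auto elim: dvdE)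
  have "a + b \<ge> 0" using as sumset_nonneg[OF d] by (simp add: \<Gamma>\<^sub>s_def)
  then have "z \<ge> 0" using z D_pos by (simp add: zero_le_mult_iff)
  then have "a + b = int (nat z) * D" using z by simp
  moreover have "b \<in> sumset (nat z + d)" using d sumset_mono[of d "nat z + d"] by auto
  ultimately show ?thesis using claim as by blast
qed

text \<open>
  In terms of \<open>e - (2r - 2)\<close>, the generators near \<open>2r\<close> (together with \<open>r + r\<close>) are
  \<open>0, 1, 2, 3, 5, 7, \<dots>, 2n + 1\<close>. Sums of \<open>i + 1\<close> of these fill a whole interval.
\<close>

lemma \<Gamma>\<^sub>t_block:
  assumes "0 \<le> u" "u \<le> (2 * int n + 1) * int i + 3"
  shows "(2 * int r - 2) * int (Suc i) + u \<in> \<Gamma>\<^sub>t"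
  using assms
proof (induction i arbitrary: u)
  case 0
  then consider "u = 0" | "u = 1" | "u = 2" | "u = 3" by fastforce
  then show ?case
  proof cases
    case 1
    then show ?thesis using E_basic E_subset_\<Gamma>\<^sub>t by auto
  next
    case 2
    have "2 * int r - 1 \<in> E" using n_pos by (intro E_odd) (auto simp: D_def)
    then show ?thesis using 2 E_subset_\<Gamma>\<^sub>t by auto
  next
    case 3
    have "int r \<in> \<Gamma>\<^sub>t" using E_basic E_subset_\<Gamma>\<^sub>t by auto
    then show ?thesis using 3 \<Gamma>\<^sub>t_add[of "int r" "int r"] by simp
  next
    case 4
    have "2 * int r + 1 \<in> E" using n_pos by (intro E_odd) (auto simp: D_def)
    then show ?thesis using 4 E_subset_\<Gamma>\<^sub>t by (auto simp: add.commute)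
  qed
next
  case (Suc i)
  have step: ?case if "w \<le> u" "u - w \<le> (2 * int n + 1) * int i + 3" "2 * int r - 2 + w \<in> E" for w
  proof -
    have "(2 * int r - 2 + w) + ((2 * int r - 2) * int (Suc i) + (u - w)) \<in> \<Gamma>\<^sub>t"
      using that E_subset_\<Gamma>\<^sub>t by (intro \<Gamma>\<^sub>t_add[OF _ Suc.IH]) auto
    then show ?thesis by (simp add: algebra_simps)
  qed
  have b: "u \<le> (2 * int n + 1) * int i + (2 * int n + 1) + 3"
    using Suc.prems(2) by (simp add: algebra_simps)
  have i0: "0 \<le> (2 * int n + 1) * int i" by simp
  have odd_in: "2 * int r - 2 + w \<in> E" if "odd w" "1 \<le> w" "w \<le> 2 * int n + 1" for w
    using that by (intro E_odd) (auto simp: D_def)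
  consider "u \<ge> 2 * int n + 1" | "odd u" "u < 2 * int n + 1" | "u = 0" | "even u" "0 < u" "u < 2 * int n + 1"
    using Suc.prems by linarith
  then show ?case
  proof cases
    case 1
    then show ?thesis using b by (intro step[of "2 * int n + 1"] odd_in) auto
  next
    case 2
    have "u \<ge> 1" using 2 Suc.prems(1) by (cases "u = 0") auto
    then show ?thesis using 2 i0 by (intro step[of u] odd_in) auto
  next
    case 3
    then show ?thesis using i0 E_basic by (intro step[of 0]) auto
  next
    case 4
    then have "u \<ge> 2" by (cases "u = 1") auto
    then show ?thesis using 4 i0 by (intro step[of "u - 1"] odd_in) auto
  qed
qed

text \<open>
  The blocks of \<open>\<Gamma>\<^sub>t_block\<close>, interleaved with their translates by \<open>r\<close>, leave no gaps from the block
  of the sums of \<open>j\<close> generators on: the assumption on \<open>j\<close> says that this block reaches up to the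
  beginning of its translate by \<open>r\<close>, and the translate then reaches the next block.
\<close>

lemma \<Gamma>\<^sub>t_conductor:
  assumes j: "int r + 2 * int n - 3 \<le> (2 * int n + 1) * j" and b: "(2 * int r - 2) * j \<le> b"
  shows "b \<in> \<Gamma>\<^sub>t"
proof -
  define z where "z = 2 * int r - 2"
  have z: "z > 0" using r_bound by (simp add: z_def)
  define q u where "q = b div z" and "u = b mod z"
  have bqu: "b = z * q + u" and u: "0 \<le> u" "u < z"
    using z by (auto simp: q_def u_def)
  have "(2 * int n + 1) * j > 0" using j r_bound n_pos by linarith
  then have "j > 0" using n_pos by (simp add: zero_less_mult_iff)
  have "j \<le> q"
  proof -
    have "(j * z) div z \<le> b div z"
      using b z by (intro zdiv_mono1) (auto simp: z_def mult.commute)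
    then show ?thesis using z by (simp add: q_def)
  qed
  then have q1: "q \<ge> 1" using \<open>j > 0\<close> by simp
  define i where "i = nat (q - 1)"
  have qi: "q = int (Suc i)" using q1 by (simp add: i_def)
  have "(2 * int n + 1) * j \<le> (2 * int n + 1) * q"
    using \<open>j \<le> q\<close> by (intro mult_left_mono) auto
  then have qb: "int r + 2 * int n - 3 \<le> (2 * int n + 1) * int i + (2 * int n + 1)"
    using j by (simp add: qi algebra_simps)
  show ?thesis
  proof (cases "u \<le> (2 * int n + 1) * int i + 3")
    case True
    then show ?thesis using \<Gamma>\<^sub>t_block[OF u(1)] bqu qi by (simp add: z_def)
  next
    case False
    have "z * int (Suc i) + (u - int r) \<in> \<Gamma>\<^sub>t"
      unfolding z_def
    proof (rule \<Gamma>\<^sub>t_block)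
      show "0 \<le> u - int r" using False qb by linarith
      show "u - int r \<le> (2 * int n + 1) * int i + 3"
        using u qb unfolding z_def by linarith
    qed
    moreover have "int r \<in> \<Gamma>\<^sub>t" using E_basic E_subset_\<Gamma>\<^sub>t by auto
    ultimately have "(z * int (Suc i) + (u - int r)) + int r \<in> \<Gamma>\<^sub>t" by (rule \<Gamma>\<^sub>t_add)
    then show ?thesis using bqu qi by simp
  qed
qed

lemma sumset_complement_bound:
  assumes "b \<in> sumset d"
  shows "int d * D - b \<le> int d * (2 * int n + 1) \<or>
    (\<exists>d'. d = Suc d' \<and> (b \<in> sumset d' \<or> b - int r \<in> sumset d'))"
  using assms
proof (induction d arbitrary: b)
  case (Suc d)
  then obtain e x where e: "e \<in> E" and x: "x \<in> sumset d" and b: "b = e + x" by (auto elim: sumset_SucE)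
  consider "e = 0" | "e = int r" | "e \<noteq> 0" "e \<noteq> int r" by blast
  then show ?case
  proof cases
    case 3
    consider "int d * D - x \<le> int d * (2 * int n + 1)" | d' where "d = Suc d'" "x \<in> sumset d'"
      | d' where "d = Suc d'" "x - int r \<in> sumset d'"
      using Suc.IH[OF x] by blast
    then show ?thesis
    proof cases
      case 1
      have "e \<ge> 2 * int r - 2" using e 3 by (auto elim: E_cases)
      then show ?thesis using 1 b by (simp add: algebra_simps D_def)
    next
      case (2 d')
      then show ?thesis using sumset_SucI[OF e] b by blast
    next
      case (3 d')
      then have "e + (x - int r) \<in> sumset d" using sumset_SucI[OF e] by blast
      then show ?thesis using b by (simp add: add_diff_eq)
    qed
  qed (use b x in auto)
qed simp

text \<open>
  Pass to complements: \<open>r + 4n - 2\<close> is a sum of \<open>j + 2\<close> numbers \<open>D - e\<close>. A summand \<open>D\<close> (from \<open>e = 0\<close>)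
  would leave \<open>2n - 1 - r\<close>, which lies in \<open>\<Gamma>\<^sub>s\<close> only if \<open>3r\<close> is a generator; a summand \<open>D - r\<close> would
  leave \<open>2n - 1 \<notin> \<Gamma>\<^sub>s\<close>. So each summand is at most \<open>2n + 1\<close>.
\<close>

lemma gap_bound:
  assumes "3 * int r \<notin> sumset 2" "3 * int r + int j * D \<in> sumset (j + 2)"
  shows "int r + 4 * int n - 2 \<le> (int j + 2) * (2 * int n + 1)"
proof -
  have no1: "3 * int r + int j * D \<notin> sumset (Suc j)"
  proof
    assume "3 * int r + int j * D \<in> sumset (Suc j)"
    from sumset_complement[OF this] have *: "2 * int n - 1 - int r \<in> \<Gamma>\<^sub>s"
      by (simp add: algebra_simps D_def)
    then have "even (2 * int n - 1 - int r)" using r_bound by (auto simp: \<Gamma>\<^sub>s_def)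
    then have "3 * int r \<in> E" using * by (intro E_odd) (auto simp: D_def \<Gamma>\<^sub>s_def)
    then have "3 * int r \<in> sumset 2" using sumset_mono[of 1 2] sumset_1 by auto
    then show False using assms(1) by blast
  qed
  have no2: "3 * int r + int j * D - int r \<notin> sumset (Suc j)"
  proof
    assume "3 * int r + int j * D - int r \<in> sumset (Suc j)"
    from sumset_complement[OF this] have "2 * int n - 1 \<in> \<Gamma>\<^sub>s"
      by (simp add: algebra_simps D_def)
    then show False by (auto simp: \<Gamma>\<^sub>s_def)
  qed
  from sumset_complement_bound[OF assms(2)] no1 no2
  have "int (j + 2) * D - (3 * int r + int j * D) \<le> int (j + 2) * (2 * int n + 1)" by auto
  then show ?thesis by (simp add: algebra_simps D_def)
qed

text \<open>
  If \<open>a \<notin> \<Gamma>\<^sub>s\<close> then \<open>a \<le> 2n - 1\<close>, so that \<open>b\<close> is large; \<open>gap_bound\<close> supplies the hypothesis under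
  which \<open>\<Gamma>\<^sub>t_conductor\<close> puts \<open>b\<close> into \<open>\<Gamma>\<^sub>t\<close>.
\<close>

lemma points_of_high_degree:
  assumes "3 * int r \<notin> sumset 2" "3 * int r + int k * D \<in> sumset (k + 2)"
    and "a + b = j * D" "j \<ge> int k + 1"
  shows "(a, b) \<in> L\<^sub>X \<union> L\<^sub>Y"
proof (cases "a \<in> \<Gamma>\<^sub>s")
  case True
  then show ?thesis using assms(3) by (auto simp: L\<^sub>Y_def)
next
  case False
  then have a: "a \<le> 2 * int n - 1" by (auto simp: \<Gamma>\<^sub>s_def) presburger
  have "(2 * int n + 1) * (int k + 1) \<le> (2 * int n + 1) * j"
    using assms(4) by (intro mult_left_mono) auto
  then have "int r + 2 * int n - 3 \<le> (2 * int n + 1) * j"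
    using gap_bound[OF assms(1,2)] by (simp add: algebra_simps)
  moreover have "(2 * int r - 2) * j \<le> b"
  proof -
    have "b = j * D - a" using assms(3) by simp
    moreover have "(2 * int n + 1) * 1 \<le> (2 * int n + 1) * j"
      using assms(4) by (intro mult_left_mono) auto
    ultimately show ?thesis using a by (simp add: D_def algebra_simps)
  qed
  ultimately have "b \<in> \<Gamma>\<^sub>t" by (rule \<Gamma>\<^sub>t_conductor)
  then show ?thesis using assms(3) by (auto simp: L\<^sub>X_def)
qed

lemma localize_X: "(\<exists>N. (a + int N * D, b) \<in> S) \<longleftrightarrow> (a, b) \<in> L\<^sub>X"
proof
  assume "\<exists>N. (a + int N * D, b) \<in> S"
  then obtain N d where d: "a + int N * D + b = int d * D" "b \<in> sumset d"
    by (auto simp: S_ge_def)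
  have "a + b = D * (int d - int N)" using d(1) by (simp add: algebra_simps)
  then show "(a, b) \<in> L\<^sub>X" using d(2) by (auto simp: L\<^sub>X_def \<Gamma>\<^sub>t_def)
next
  assume "(a, b) \<in> L\<^sub>X"
  then obtain d z where d: "b \<in> sumset d" "a + b = D * z"
    by (auto simp: L\<^sub>X_def \<Gamma>\<^sub>t_def elim!: dvdE)
  define N where "N = nat (int d - z)"
  have "int d \<le> z + int N" by (simp add: N_def)
  then have "d \<le> nat (z + int N)" by linarith
  then have "b \<in> sumset (nat (z + int N))"
    using d(1) sumset_mono by blast
  moreover have "a + int N * D + b = int (nat (z + int N)) * D"
    using d(2) by (simp add: N_def algebra_simps)
  ultimately show "\<exists>N. (a + int N * D, b) \<in> S" unfolding S_ge_def by blast
qed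

lemma localize_Y: "(\<exists>N. (a, b + int N * D) \<in> S) \<longleftrightarrow> (a, b) \<in> L\<^sub>Y"
proof
  assume "\<exists>N. (a, b + int N * D) \<in> S"
  then obtain N d where d: "a + (b + int N * D) = int d * D" "b + int N * D \<in> sumset d"
    by (auto simp: S_ge_def)
  have "a + b = D * (int d - int N)" using d(1) by (simp add: algebra_simps)
  moreover have "a = int d * D - (b + int N * D)" using d(1) by simp
  ultimately show "(a, b) \<in> L\<^sub>Y" using sumset_complement[OF d(2)] by (auto simp: L\<^sub>Y_def)
next
  assume "(a, b) \<in> L\<^sub>Y"
  then obtain z where d: "a \<in> \<Gamma>\<^sub>s" "a + b = D * z"
    by (auto simp: L\<^sub>Y_def elim!: dvdE)
  have "a \<ge> 0" using d by (simp add: \<Gamma>\<^sub>s_def)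
  define N where "N = nat (a - z)"
  define m where "m = nat (z + int N)"
  have m: "int m = z + int N" "int m \<ge> a" using \<open>a \<ge> 0\<close> by (auto simp: m_def N_def)
  have "a \<le> int m * 1" using m by simp
  also have "\<dots> \<le> int m * (2 * int n + 1)" by (intro mult_left_mono) auto
  finally have "int m * D - a \<in> sumset m" by (rule complement_in_sumset[OF d(1)])
  moreover have "b + int N * D = int m * D - a"
    using d(2) m(1) by (simp add: algebra_simps)
  ultimately have "(a, b + int N * D) \<in> S" by (auto simp: S_ge_def)
  then show "\<exists>N. (a, b + int N * D) \<in> S" by blast
qed

text \<open>
  Moving far in an interior direction reaches \<open>\<Gamma>\<^sub>s\<close> and \<open>\<Gamma>\<^sub>t\<close> in both coordinates, and also passes the
  vertical line that carries the exceptional points.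
\<close>

lemma localize_interior:
  assumes "(a, b) \<in> G" "(v, w) \<in> G" "v > 0" "w > 0"
  shows "\<exists>N. (a + int N * v, b + int N * w) \<in> S"
proof -
  define c where "c = (2 * int r - 2) * (int r + 2 * int n)"
  define M where "M = int r + 4 * int n + \<bar>a\<bar> + \<bar>b\<bar> + \<bar>c\<bar>"
  define N where "N = nat M"
  have N: "int N = M" by (simp add: N_def M_def)
  have "M \<ge> 0" by (simp add: M_def)
  then have "M * 1 \<le> M * v" "M * 1 \<le> M * w"
    using assms(3,4) by (intro mult_left_mono; simp)+
  moreover have "M \<ge> int r + 4 * int n - a" "M \<ge> c - b" by (simp_all add: M_def)
  ultimately have big: "a + M * v \<ge> int r + 4 * int n" "b + M * w \<ge> c"
    by linarith+
  have "D dvd (a + b) + M * (v + w)" using assms(1,2) by (auto simp: G_def)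
  then have dv: "D dvd (a + M * v) + (b + M * w)" by (simp add: algebra_simps)
  have "b + M * w \<in> \<Gamma>\<^sub>t"
  proof (rule \<Gamma>\<^sub>t_conductor)
    have "1 * (int r + 2 * int n) \<le> (2 * int n + 1) * (int r + 2 * int n)"
      by (intro mult_right_mono) auto
    also have "1 * (int r + 2 * int n) = int r + 2 * int n" by simp
    finally show "int r + 2 * int n - 3 \<le> (2 * int n + 1) * (int r + 2 * int n)" by linarith
  qed (use big in \<open>simp add: c_def\<close>)
  moreover have "a + M * v \<in> \<Gamma>\<^sub>s" using big(1) r_bound by (simp add: \<Gamma>\<^sub>s_def)
  ultimately have "(a + M * v, b + M * w) \<in> L\<^sub>X \<inter> L\<^sub>Y" using dv by (simp add: L\<^sub>X_def L\<^sub>Y_def)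
  from saturation_cases[OF this] have "(a + M * v, b + M * w) \<in> S" using big(1) by auto
  then show ?thesis using N by metis
qed

end


section \<open>Spans of Laurent monomials\<close>

abbreviation var_s :: "'k::field poly poly fract" where "var_s \<equiv> monom_st 1 0"
abbreviation var_t :: "'k::field poly poly fract" where "var_t \<equiv> monom_st 0 1"

definition laurent :: "int \<times> int \<Rightarrow> 'k::field poly poly fract" where
  "laurent g = var_s powi fst g * var_t powi snd g"

text \<open>
  The rings and modules below are spanned over \<open>K\<close> by Laurent monomials, so they are described by
  their sets of exponents.
\<close>

definition mspan :: "(int \<times> int) set \<Rightarrow> 'k::field poly poly fract set" where
  "mspan T = {\<Sum>g\<in>F. const_st (c g) * laurent g |F c. finite F \<and> F \<subseteq> T}"

definition poly_st :: "'k::field poly poly \<Rightarrow> 'k poly poly fract" where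
  "poly_st p = Fraction_Field.Fract p 1"

lemma poly_st_0 [simp]: "poly_st 0 = 0" and poly_st_1 [simp]: "poly_st 1 = 1"
  by (simp_all add: poly_st_def fract_collapse)

lemma poly_st_add: "poly_st (p + q) = poly_st p + poly_st q"
  and poly_st_mult: "poly_st (p * q) = poly_st p * poly_st q"
  by (simp_all add: poly_st_def)

lemma poly_st_sum: "poly_st (sum f A) = (\<Sum>a\<in>A. poly_st (f a))"
  by (induction A rule: infinite_finite_induct) (simp_all add: poly_st_add)

lemma poly_st_eq_iff: "poly_st p = poly_st q \<longleftrightarrow> p = q"
  by (simp add: poly_st_def eq_fract)

lemma Fract_eq_divide: "q \<noteq> 0 \<Longrightarrow> Fraction_Field.Fract p q = poly_st p / poly_st q"
  by (simp add: poly_st_def)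

lemma const_st_eq: "const_st c = poly_st [:[:c:]:]"
  by (simp add: const_st_def poly_st_def)

lemma const_st_simps [simp]:
  "const_st 0 = 0" "const_st 1 = 1"
  "const_st (a + b) = const_st a + const_st b"
  "const_st (a * b) = const_st a * const_st b"
  by (simp_all add: const_st_eq flip: poly_st_add poly_st_mult one_pCons)

lemma const_st_diff [simp]: "const_st (a - b) = const_st a - const_st b"
  by (metis add_diff_cancel_right' const_st_simps(3) diff_add_cancel)

lemma const_st_uminus [simp]: "const_st (- a) = - const_st a"
  by (metis const_st_diff const_st_simps(1) diff_0)

lemma monom_st_eq: "monom_st i j = poly_st (Polynomial.monom (Polynomial.monom 1 i) j)"
  by (simp add: monom_st_def poly_st_def)

lemma monom_st_mult: "monom_st i j * monom_st i' j' = monom_st (i + i') (j + j')"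
  by (simp add: monom_st_eq mult_monom flip: poly_st_mult)

lemma monom_st_nonzero: "monom_st i j \<noteq> (0 :: 'k::field poly poly fract)"
proof -
  have "Polynomial.monom (Polynomial.monom 1 i) j \<noteq> (0 :: 'k poly poly)"
    by (simp add: monom_eq_0_iff)
  then show ?thesis unfolding monom_st_eq by (metis poly_st_eq_iff poly_st_0)
qed

lemma monom_st_00: "monom_st 0 0 = 1"
  by (simp add: monom_st_eq monom_0 flip: one_pCons)

lemma monom_st_s: "monom_st i 0 = (var_s :: 'k::field poly poly fract) ^ i"
proof (induction i)
  case (Suc i)
  have "monom_st (Suc i) 0 = (var_s :: 'k poly poly fract) * monom_st i 0" by (simp add: monom_st_mult)
  also have "\<dots> = var_s ^ Suc i" by (simp only: Suc power_Suc)
  finally show ?case .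
qed (simp add: monom_st_00)

lemma monom_st_t: "monom_st 0 j = (var_t :: 'k::field poly poly fract) ^ j"
proof (induction j)
  case (Suc j)
  have "monom_st 0 (Suc j) = (var_t :: 'k poly poly fract) * monom_st 0 j" by (simp add: monom_st_mult)
  also have "\<dots> = var_t ^ Suc j" by (simp only: Suc power_Suc)
  finally show ?case .
qed (simp add: monom_st_00)

lemma laurent_add: "laurent (g + h) = laurent g * laurent h"
  by (simp add: laurent_def power_int_add monom_st_nonzero)

lemma laurent_0 [simp]: "laurent 0 = 1"
  by (simp add: laurent_def)

lemma laurent_nonzero: "laurent g \<noteq> 0"
  by (simp add: laurent_def monom_st_nonzero)

lemma laurent_nat: "laurent (int i, int j) = (monom_st i j :: 'k::field poly poly fract)"
proof -
  have "laurent (int i, int j) = (monom_st i 0 * monom_st 0 j :: 'k poly poly fract)"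
    by (simp only: laurent_def monom_st_s[of i] monom_st_t[of j] fst_conv snd_conv power_int_of_nat)
  then show ?thesis by (simp add: monom_st_mult)
qed

lemma laurent_prod: "finite I \<Longrightarrow> (\<Prod>i\<in>I. laurent (f i)) = laurent (\<Sum>i\<in>I. f i)"
  by (induction I rule: finite_induct) (simp_all add: laurent_add)

lemma laurent_power: "laurent g ^ m = laurent (int m * fst g, int m * snd g)"
proof (induction m)
  case 0
  then show ?case using laurent_0 by (simp add: zero_prod_def)
next
  case (Suc m)
  have "(int (Suc m) * fst g, int (Suc m) * snd g) = g + (int m * fst g, int m * snd g)"
    by (cases g) (simp add: distrib_right)
  then show ?case using Suc by (simp only: laurent_add power_Suc)
qed

text \<open>
  After multiplication by a high power of \<open>s t\<close>, a vanishing combination becomes a vanishing polynomial,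
  whose coefficients can be read off.
\<close>

lemma laurent_independent:
  assumes "finite F" "(\<Sum>g\<in>F. const_st (c g) * laurent g) = (0 :: 'k::field poly poly fract)" "h \<in> F"
  shows "c h = 0"
proof -
  define N where "N = (\<Sum>g\<in>F. nat \<bar>fst g\<bar> + nat \<bar>snd g\<bar>)"
  have N: "- fst g \<le> int N" "- snd g \<le> int N" if "g \<in> F" for g
  proof -
    have "nat \<bar>fst g\<bar> + nat \<bar>snd g\<bar> \<le> N"
      unfolding N_def by (intro member_le_sum assms(1) that) auto
    then show "- fst g \<le> int N" "- snd g \<le> int N" by linarith+
  qed
  define e where "e g = (nat (fst g + int N), nat (snd g + int N))" for g :: "int \<times> int"
  have e: "laurent g * laurent (int N, int N) = (monom_st (fst (e g)) (snd (e g)) :: 'k poly poly fract)"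
    if "g \<in> F" for g
    using N[OF that] by (simp add: e_def flip: laurent_add laurent_nat) (simp add: plus_prod_def)
  have inj: "e g = e h \<longleftrightarrow> g = h" if "g \<in> F" for g
    using N[OF that] N[OF assms(3)] by (auto simp: e_def prod_eq_iff)
  define p where "p = (\<Sum>g\<in>F. Polynomial.monom (Polynomial.monom (c g) (fst (e g))) (snd (e g)))"
  have "poly_st p = (\<Sum>g\<in>F. const_st (c g) * laurent g) * laurent (int N, int N)"
    unfolding p_def poly_st_sum sum_distrib_right
  proof (rule sum.cong[OF refl])
    fix g assume "g \<in> F"
    then show "poly_st (Polynomial.monom (Polynomial.monom (c g) (fst (e g))) (snd (e g)))
        = const_st (c g) * laurent g * laurent (int N, int N)"
      by (simp add: mult.assoc e const_st_eq monom_st_eq smult_monom flip: poly_st_mult)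
  qed
  also have "\<dots> = poly_st 0" using assms(2) by simp
  finally have "p = 0" by (simp only: poly_st_eq_iff)
  then have "0 = Polynomial.coeff (Polynomial.coeff p (snd (e h))) (fst (e h))" by simp
  also have "\<dots> = (\<Sum>g\<in>F. if g = h then c g else 0)"
    unfolding p_def coeff_sum
  proof (rule sum.cong[OF refl])
    fix g assume "g \<in> F"
    then show "Polynomial.coeff (Polynomial.coeff (Polynomial.monom (Polynomial.monom (c g) (fst (e g))) (snd (e g)))
        (snd (e h))) (fst (e h)) = (if g = h then c g else 0)"
      using inj[of g] by (auto simp: prod_eq_iff[of "e g" "e h"])
  qed
  also have "\<dots> = c h" using assms(1,3) by simp
  finally show ?thesis by simp
qed

lemma mspanI: "finite F \<Longrightarrow> F \<subseteq> T \<Longrightarrow> (\<Sum>g\<in>F. const_st (c g) * laurent g) \<in> mspan T"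
  unfolding mspan_def by blast

lemma mspanE:
  assumes "x \<in> mspan T"
  obtains F c where "finite F" "F \<subseteq> T" "x = (\<Sum>g\<in>F. const_st (c g) * laurent g)"
  using assms unfolding mspan_def by blast

lemma mspan_mono: "T \<subseteq> U \<Longrightarrow> mspan T \<subseteq> mspan U"
  unfolding mspan_def by blast

lemma mspan_0 [simp]: "0 \<in> mspan T"
  using mspanI[of "{}"] by simp

lemma mspan_laurent: "g \<in> T \<Longrightarrow> const_st a * laurent g \<in> mspan T"
  using mspanI[of "{g}" T "\<lambda>_. a"] by simp

lemma mspan_laurent1: "g \<in> T \<Longrightarrow> laurent g \<in> mspan T"
  using mspan_laurent[of g T 1] by simp

lemma sum_extend:
  assumes "finite F'" "F \<subseteq> F'"
  shows "(\<Sum>g\<in>F. const_st (c g) * laurent g) =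
    (\<Sum>g\<in>F'. const_st (if g \<in> F then c g else 0) * laurent g)"
  using assms by (intro sum.mono_neutral_cong_left) auto

lemma mspan_add:
  assumes "x \<in> mspan T" "y \<in> mspan T"
  shows "x + y \<in> mspan T"
proof -
  obtain F c where F: "finite F" "F \<subseteq> T" "x = (\<Sum>g\<in>F. const_st (c g) * laurent g)"
    using assms(1) by (rule mspanE)
  obtain F' c' where F': "finite F'" "F' \<subseteq> T" "y = (\<Sum>g\<in>F'. const_st (c' g) * laurent g)"
    using assms(2) by (rule mspanE)
  define d where "d g = (if g \<in> F then c g else 0) + (if g \<in> F' then c' g else 0)" for g
  have "x + y = (\<Sum>g\<in>F \<union> F'. const_st (d g) * laurent g)"
    unfolding F(3) F'(3) d_def const_st_simps distrib_right sum.distrib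
    using F(1) F'(1) by (intro arg_cong2[of _ _ _ _ "(+)"] sum_extend) auto
  then show ?thesis using F(1,2) F'(1,2) by (auto intro!: mspanI)
qed

lemma mspan_sum: "(\<And>i. i \<in> I \<Longrightarrow> f i \<in> mspan T) \<Longrightarrow> sum f I \<in> mspan T"
  by (induction I rule: infinite_finite_induct) (auto intro: mspan_add)

lemma mspan_mult:
  assumes "x \<in> mspan T" "y \<in> mspan U" "\<And>g h. g \<in> T \<Longrightarrow> h \<in> U \<Longrightarrow> g + h \<in> V"
  shows "x * y \<in> mspan V"
proof -
  obtain F c where F: "F \<subseteq> T" "x = (\<Sum>g\<in>F. const_st (c g) * laurent g)"
    using assms(1) by (rule mspanE)
  obtain F' c' where F': "F' \<subseteq> U" "y = (\<Sum>g\<in>F'. const_st (c' g) * laurent g)"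
    using assms(2) by (rule mspanE)
  have "(const_st (c g) * laurent g) * (const_st (c' h) * laurent h) \<in> mspan V"
    if "g \<in> F" "h \<in> F'" for g h
  proof -
    have "const_st (c g * c' h) * laurent (g + h) \<in> mspan V"
      using that F(1) F'(1) by (intro mspan_laurent assms(3)) auto
    then show ?thesis by (simp add: laurent_add mult_ac)
  qed
  then show ?thesis unfolding F(2) F'(2) sum_product by (intro mspan_sum)
qed

lemma mspan_uminus:
  assumes "x \<in> mspan T" shows "- x \<in> mspan T"
proof -
  have "const_st (- 1) * laurent 0 * x \<in> mspan T"
    by (rule mspan_mult[OF mspan_laurent[of 0 "{0}"] assms]) auto
  then show ?thesis by simp
qed

lemma mspan_diff: "x \<in> mspan T \<Longrightarrow> y \<in> mspan T \<Longrightarrow> x - y \<in> mspan T"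
  using mspan_add[OF _ mspan_uminus, of x T y] by simp

lemma mspan_split:
  assumes "x \<in> mspan T"
  obtains y z where "x = y + z" "y \<in> mspan (T \<inter> U)" "z \<in> mspan (T - U)"
proof -
  obtain F c where F: "finite F" "F \<subseteq> T" "x = (\<Sum>g\<in>F. const_st (c g) * laurent g)"
    using assms by (rule mspanE)
  let ?f = "\<lambda>g. const_st (c g) * laurent g"
  have "F = (F \<inter> U) \<union> (F - U)" by blast
  then have "x = sum ?f (F \<inter> U) + sum ?f (F - U)"
    using sum.union_disjoint[of "F \<inter> U" "F - U" ?f] F by auto
  moreover have "sum ?f (F \<inter> U) \<in> mspan (T \<inter> U)" "sum ?f (F - U) \<in> mspan (T - U)"
    using F by (auto intro!: mspanI)
  ultimately show ?thesis by (rule that)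
qed

text \<open>
  This is linear independence in the form in which it gets used: two expansions of \<open>x\<close> agree term by
  term.
\<close>

lemma mspan_Int:
  assumes "x \<in> mspan T" "x \<in> mspan U"
  shows "x \<in> mspan (T \<inter> U)"
proof -
  obtain F c where F: "finite F" "F \<subseteq> T" "x = (\<Sum>g\<in>F. const_st (c g) * laurent g)"
    using assms(1) by (rule mspanE)
  obtain F' c' where F': "finite F'" "F' \<subseteq> U" "x = (\<Sum>g\<in>F'. const_st (c' g) * laurent g)"
    using assms(2) by (rule mspanE)
  define d d' where "d g = (if g \<in> F then c g else 0)" and "d' g = (if g \<in> F' then c' g else 0)" for g
  have x: "x = (\<Sum>g\<in>F \<union> F'. const_st (d g) * laurent g)" "x = (\<Sum>g\<in>F \<union> F'. const_st (d' g) * laurent g)"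
    unfolding d_def d'_def using F F' sum_extend[of "F \<union> F'" F c] sum_extend[of "F \<union> F'" F' c'] by simp_all
  then have "(\<Sum>g\<in>F \<union> F'. const_st (d g - d' g) * laurent g) = 0"
    unfolding const_st_diff left_diff_distrib sum_subtractf by simp
  then have eq: "d g = d' g" if "g \<in> F \<union> F'" for g
    using laurent_independent[of "F \<union> F'" "\<lambda>g. d g - d' g" g] that F(1) F'(1) by simp
  have "x = (\<Sum>g\<in>F \<inter> F'. const_st (d g) * laurent g)"
    unfolding x(1)
  proof (rule sum.mono_neutral_right)
    show "\<forall>g\<in>F \<union> F' - F \<inter> F'. const_st (d g) * laurent g = 0"
    proof
      fix g assume g: "g \<in> F \<union> F' - F \<inter> F'"
      then have "d g = 0" using eq[of g] by (auto simp: d_def d'_def split: if_splits)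
      then show "const_st (d g) * laurent g = 0" by simp
    qed
  qed (use F(1) F'(1) in auto)
  then show ?thesis using F F' by (auto intro!: mspanI)
qed

lemma mspan_empty: "mspan {} = {0}"
  by (auto elim: mspanE)

lemma mspan_disjoint: "x \<in> mspan T \<Longrightarrow> x \<in> mspan U \<Longrightarrow> T \<inter> U = {} \<Longrightarrow> x = 0"
  using mspan_Int[of x T U] by (simp add: mspan_empty)

lemma mspan_Un:
  "x \<in> mspan (T \<union> U) \<longleftrightarrow> (\<exists>y\<in>mspan T. \<exists>z\<in>mspan U. x = y + z)"
proof
  assume "x \<in> mspan (T \<union> U)"
  then obtain y z where "x = y + z" "y \<in> mspan ((T \<union> U) \<inter> T)" "z \<in> mspan ((T \<union> U) - T)"
    by (rule mspan_split)
  then show "\<exists>y\<in>mspan T. \<exists>z\<in>mspan U. x = y + z"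
    using mspan_mono[of "(T \<union> U) \<inter> T" T] mspan_mono[of "(T \<union> U) - T" U] by blast
next
  assume "\<exists>y\<in>mspan T. \<exists>z\<in>mspan U. x = y + z"
  then show "x \<in> mspan (T \<union> U)"
    using mspan_mono[of T "T \<union> U"] mspan_mono[of U "T \<union> U"] by (auto intro: mspan_add)
qed

text \<open>
  Inverting a monomial keeps the exponents that multiplication by some power of it brings into \<open>T\<close>. A
  finite sum needs a single power for all of its terms, whence the closure assumption.
\<close>

lemma localization_mspan:
  assumes "\<And>g. g \<in> T \<Longrightarrow> g + v \<in> T"
  shows "localization_at (mspan T) (laurent v :: 'k::field poly poly fract) = mspan {g. \<exists>N. (fst g + int N * fst v, snd g + int N * snd v) \<in> T}"
    (is "_ = mspan ?L")
proof (intro equalityI subsetI)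
  fix x :: "'k poly poly fract" assume "x \<in> localization_at (mspan T) (laurent v)"
  then obtain a N where a: "a \<in> mspan T" "x = a / laurent v ^ N"
    by (auto simp: localization_at_def)
  let ?w = "(- int N * fst v, - int N * snd v)"
  have "laurent ?w * laurent v ^ N = (laurent (?w + (int N * fst v, int N * snd v)) :: 'k poly poly fract)"
    by (simp only: laurent_add laurent_power)
  also have "?w + (int N * fst v, int N * snd v) = 0" by (simp add: zero_prod_def)
  finally have "laurent ?w * laurent v ^ N = (1 :: 'k poly poly fract)" by simp
  then have "laurent ?w = 1 / (laurent v :: 'k poly poly fract) ^ N"
    by (simp add: laurent_nonzero nonzero_eq_divide_eq)
  then have "x = laurent ?w * a" using a(2) by (simp only: times_divide_eq_left mult_1)
  also have "\<dots> \<in> mspan ?L"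
    by (rule mspan_mult[OF mspan_laurent1[of ?w "{?w}"] a(1)]) (auto intro!: exI[of _ N])
  finally show "x \<in> mspan ?L" .
next
  fix x assume "x \<in> mspan ?L"
  then obtain F c where F: "finite F" "F \<subseteq> ?L" "x = (\<Sum>g\<in>F. const_st (c g) * laurent g)"
    by (rule mspanE)
  then have "\<forall>g\<in>F. \<exists>N. (fst g + int N * fst v, snd g + int N * snd v) \<in> T" by auto
  then obtain N where N: "\<And>g. g \<in> F \<Longrightarrow> (fst g + int (N g) * fst v, snd g + int (N g) * snd v) \<in> T"
    by metis
  have T_mult: "(fst g + int M * fst v, snd g + int M * snd v) \<in> T"
    if "(fst g + int M' * fst v, snd g + int M' * snd v) \<in> T" "M' \<le> M" for g M M'
    using that(2,1)
  proof (induction M rule: dec_induct)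
    case (step M)
    then show ?case using assms[OF step.IH[OF step.prems]] by (cases v) (simp add: algebra_simps)
  qed
  define M where "M = (\<Sum>g\<in>F. N g)"
  have "N g \<le> M" if "g \<in> F" for g
    unfolding M_def by (rule member_le_sum[OF that]) (use F in auto)
  then have inT: "g + (int M * fst v, int M * snd v) \<in> T" if "g \<in> F" for g
    using T_mult[OF N[OF that], of M] that by (cases g) auto
  have "x * laurent v ^ M = (\<Sum>g\<in>F. const_st (c g) * laurent (g + (int M * fst v, int M * snd v)))"
    unfolding F(3) sum_distrib_right laurent_power laurent_add by (simp add: mult.assoc)
  also have "\<dots> \<in> mspan T" using inT by (intro mspan_sum mspan_laurent)
  finally have "x * laurent v ^ M \<in> mspan T" .
  moreover have "x = x * laurent v ^ M / laurent v ^ M" by (simp add: laurent_nonzero)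
  ultimately show "x \<in> localization_at (mspan T) (laurent v)"
    unfolding localization_at_def by blast
qed

lemma mspan_translateE:
  assumes "x \<in> mspan ((+) g ` T)"
  obtains y where "y \<in> mspan T" "x = laurent g * (y :: 'k::field poly poly fract)"
proof
  have "laurent (- g) * x \<in> mspan T"
    using mspan_laurent1[of "- g" "{- g}", OF singletonI] assms
  proof (rule mspan_mult)
    fix g' h assume "g' \<in> {- g}" "h \<in> (+) g ` T"
    then show "g' + h \<in> T" by force
  qed
  then show "laurent (- g) * x \<in> mspan T" .
  have "laurent g * laurent (- g) = (1 :: 'k poly poly fract)"
    by (simp flip: laurent_add)
  then show "x = laurent g * (laurent (- g) * x)" by (simp add: mult.assoc[symmetric])
qed

definition degree_set :: "int \<Rightarrow> (int \<times> int) set" where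
  "degree_set d = {g. fst g + snd g = d}"

lemma poly_st_expand:
  "poly_st p = (\<Sum>j\<le>degree p. \<Sum>i\<le>degree (Polynomial.coeff p j).
     const_st (Polynomial.coeff (Polynomial.coeff p j) i) * laurent (int i, int j))"
proof -
  have "p = (\<Sum>j\<le>degree p. Polynomial.monom (\<Sum>i\<le>degree (Polynomial.coeff p j).
      Polynomial.monom (Polynomial.coeff (Polynomial.coeff p j) i) i) j)"
    by (simp add: poly_as_sum_of_monoms)
  then have "poly_st p = (\<Sum>j\<le>degree p. \<Sum>i\<le>degree (Polynomial.coeff p j).
     poly_st (Polynomial.monom (Polynomial.monom (Polynomial.coeff (Polynomial.coeff p j) i) i) j))"
    unfolding poly_st_sum[symmetric] monom_sum[symmetric] by simp
  also have "\<dots> = (\<Sum>j\<le>degree p. \<Sum>i\<le>degree (Polynomial.coeff p j).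
     const_st (Polynomial.coeff (Polynomial.coeff p j) i) * laurent (int i, int j))"
    by (intro sum.cong refl) (simp add: laurent_nat const_st_eq monom_st_eq smult_monom flip: poly_st_mult)
  finally show ?thesis .
qed

lemma poly_st_homogeneous:
  assumes "homogeneous_st d p"
  shows "poly_st p \<in> mspan (degree_set (int d))"
  unfolding poly_st_expand
proof (intro mspan_sum)
  fix i j
  show "const_st (Polynomial.coeff (Polynomial.coeff p j) i) * laurent (int i, int j)
      \<in> mspan (degree_set (int d))"
  proof (cases "Polynomial.coeff (Polynomial.coeff p j) i = 0")
    case False
    then have "i + j = d" using assms by (auto simp: homogeneous_st_def)
    then show ?thesis by (intro mspan_laurent) (auto simp: degree_set_def)
  qed simp
qed

lemma homogeneous_partE:
  assumes "x \<in> homogeneous_part d"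
  obtains p q e where "p \<in> mspan (degree_set (e + d))" "q \<in> mspan (degree_set e)" "q \<noteq> 0" "x * q = p"
proof -
  obtain p q e e' where *: "x = Fraction_Field.Fract p q" "q \<noteq> 0" "homogeneous_st e q"
      "homogeneous_st e' p" "int e' = int e + d"
    using assms unfolding homogeneous_part_def by blast
  have "poly_st q \<noteq> 0" using *(2) poly_st_eq_iff[of q 0] by simp
  then have "x * poly_st q = poly_st p" using * by (simp add: Fract_eq_divide)
  then show ?thesis
    using that[of "poly_st p" "int e" "poly_st q"] poly_st_homogeneous * \<open>poly_st q \<noteq> 0\<close> by metis
qed

lemma homogeneous_partI:
  assumes "q \<noteq> 0" "homogeneous_st e q" "homogeneous_st e' p" "int e' = int e + d"
  shows "Fraction_Field.Fract p q \<in> homogeneous_part d"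
  using assms unfolding homogeneous_part_def by blast

lemma homogeneous_st_monom: "homogeneous_st (i + j) (Polynomial.monom (Polynomial.monom c i) j)"
  by (auto simp: homogeneous_st_def split: if_splits)

lemma zero_homogeneous: "(0 :: 'k::field poly poly fract) \<in> homogeneous_part d"
proof -
  let ?q = "Polynomial.monom (Polynomial.monom (1::'k) (nat (- d))) 0"
  have "Fraction_Field.Fract 0 ?q \<in> homogeneous_part d"
  proof (rule homogeneous_partI)
    show "homogeneous_st (nat (- d) + 0) ?q" by (rule homogeneous_st_monom)
    show "homogeneous_st (nat d) (0 :: 'k poly poly)" by (simp add: homogeneous_st_def)
  qed (auto simp: monom_eq_0_iff)
  then show ?thesis by (simp add: fract_collapse)
qed

lemma monom_st_homogeneous: "(monom_st i j :: 'k::field poly poly fract) \<in> homogeneous_part (int (i + j))"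
  unfolding monom_st_def
proof (rule homogeneous_partI)
  show "homogeneous_st 0 (1 :: 'k poly poly)"
    using homogeneous_st_monom[of 0 0 "1 :: 'k"] by (simp add: monom_0 flip: one_pCons)
qed (auto intro: homogeneous_st_monom)

text \<open>
  If \<open>x = p / q\<close> with homogeneous \<open>p\<close> and \<open>q\<close>, then the part of \<open>x q\<close> outside the degree of \<open>p\<close>
  vanishes, and \<open>q\<close> is not a zero divisor.
\<close>

lemma mspan_homogeneous:
  assumes "x \<in> mspan T" "x \<in> homogeneous_part d"
  shows "x \<in> mspan (T \<inter> degree_set d)"
proof -
  obtain y z where yz: "x = y + z" "y \<in> mspan (T \<inter> degree_set d)" "z \<in> mspan (T - degree_set d)"
    using assms(1) by (rule mspan_split)
  obtain p q e where q: "p \<in> mspan (degree_set (e + d))" "q \<in> mspan (degree_set e)" "q \<noteq> 0" "x * q = p"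
    using assms(2) by (rule homogeneous_partE)
  have "z * q = p - y * q" using yz(1) q(4) by (simp add: algebra_simps)
  also have "\<dots> \<in> mspan (degree_set (e + d))"
    by (intro mspan_diff q mspan_mult[OF yz(2) q(2)]) (auto simp: degree_set_def)
  finally have "z * q \<in> mspan (degree_set (e + d))" .
  moreover have "z * q \<in> mspan (- degree_set (e + d))"
    by (rule mspan_mult[OF yz(3) q(2)]) (auto simp: degree_set_def)
  ultimately have "z * q = 0" by (rule mspan_disjoint) simp
  then show ?thesis using yz q(3) by simp
qed


section \<open>Cech cohomology of two-dimensional monomial rings\<close>

lemma image_neq_singleton: "a \<in> C \<Longrightarrow> f ` C \<noteq> {f a} \<longleftrightarrow> (\<exists>c\<in>C. f c \<noteq> f a)"
  by auto

lemma cech_diff_minus: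
  "cech_diff xs (\<lambda>I. c I - c' I) = (\<lambda>J. cech_diff xs c J - cech_diff xs c' J)"
  by (rule ext) (simp add: cech_diff_def right_diff_distrib sum_subtractf)

lemma cech_diff_zero: "cech_diff xs (\<lambda>_. 0) = (\<lambda>_. 0)"
  by (rule ext) (simp add: cech_diff_def)

text \<open>
  Joining the index \<open>0\<close> to a set of indices is the standard contracting homotopy. No sign enters because \<open>0\<close> is the least index. The only question later is whether the contracted cochain has its
  values in the right localizations.
\<close>

lemma cech_contraction:
  assumes c: "cech_diff xs c = (\<lambda>_. 0)" and supp: "\<And>J. \<not> J \<subseteq> {..<length xs} \<Longrightarrow> c J = 0"
    and xs: "xs \<noteq> []"
  shows "cech_diff xs (\<lambda>J. if 0 \<in> J \<or> \<not> J \<subseteq> {..<length xs} then 0 else c (insert 0 J)) = c"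
    (is "cech_diff xs ?h = c")
proof
  fix J :: "nat set"
  consider "\<not> J \<subseteq> {..<length xs}" | "J \<subseteq> {..<length xs}" "0 \<in> J" | "J \<subseteq> {..<length xs}" "0 \<notin> J"
    by blast
  then show "cech_diff xs ?h J = c J"
  proof cases
    case 1
    then show ?thesis by (simp add: cech_diff_def supp)
  next
    case 2
    then have fin: "finite J" using finite_subset by blast
    have "cech_diff xs ?h J = (\<Sum>j\<in>J. (-1) ^ card {i \<in> J. i < j} * ?h (J - {j}))"
      using 2 by (simp add: cech_diff_def)
    also have "\<dots> = (\<Sum>j\<in>J. if j = 0 then c J else 0)"
    proof (rule sum.cong[OF refl])
      fix j assume "j \<in> J"
      then show "(-1) ^ card {i \<in> J. i < j} * ?h (J - {j}) = (if j = 0 then c J else 0)"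
        using 2 by (cases "j = 0") (auto simp: insert_absorb)
    qed
    also have "\<dots> = c J" using fin 2 by simp
    finally show ?thesis .
  next
    case 3
    then have fin: "finite J" using finite_subset by blast
    have sub: "insert 0 J \<subseteq> {..<length xs}" using 3 xs by auto
    have "0 = cech_diff xs c (insert 0 J)" using c by simp
    also have "\<dots> = (\<Sum>j\<in>insert 0 J. (-1) ^ card {i \<in> insert 0 J. i < j} * c (insert 0 J - {j}))"
      using sub by (simp add: cech_diff_def)
    also have "\<dots> = (-1) ^ card {i \<in> insert 0 J. i < 0} * c (insert 0 J - {0}) +
        (\<Sum>j\<in>J. (-1) ^ card {i \<in> insert 0 J. i < j} * c (insert 0 J - {j}))"
      using fin 3(2) by (rule sum.insert)
    also have "(-1) ^ card {i \<in> insert 0 J. i < 0} * c (insert 0 J - {0}) = c J"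
      using 3 by simp
    also have "(\<Sum>j\<in>J. (-1) ^ card {i \<in> insert 0 J. i < j} * c (insert 0 J - {j}))
        = (\<Sum>j\<in>J. - ((-1) ^ card {i \<in> J. i < j} * ?h (J - {j})))"
    proof (rule sum.cong[OF refl])
      fix j assume j: "j \<in> J"
      then have "j \<noteq> 0" using 3 by metis
      then have "{i \<in> insert 0 J. i < j} = insert 0 {i \<in> J. i < j}" by auto
      moreover have "0 \<notin> {i \<in> J. i < j}" "finite {i \<in> J. i < j}" using 3 fin by auto
      ultimately have "card {i \<in> insert 0 J. i < j} = Suc (card {i \<in> J. i < j})"
        by (metis card_insert_disjoint)
      moreover have "insert 0 J - {j} = insert 0 (J - {j})" using \<open>j \<noteq> 0\<close> by auto
      moreover have "?h (J - {j}) = c (insert 0 (J - {j}))" using 3 by auto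
      ultimately show "(-1) ^ card {i \<in> insert 0 J. i < j} * c (insert 0 J - {j})
          = - ((-1) ^ card {i \<in> J. i < j} * ?h (J - {j}))"
        by simp
    qed
    also have "\<dots> = - cech_diff xs ?h J"
      using 3 by (simp only: cech_diff_def sum_negf if_True)
    finally show ?thesis by simp
  qed
qed

lemma cech_diff_constant_on_singletons:
  "cech_diff xs (\<lambda>J. if card J = 1 \<and> J \<subseteq> {..<length xs} then y else 0) = (\<lambda>_. 0)"
    (is "cech_diff xs ?k = _")
proof
  fix J :: "nat set"
  show "cech_diff xs ?k J = 0"
  proof (cases "J \<subseteq> {..<length xs} \<and> card J = 2")
    case True
    then obtain a' b' where "J = {a', b'}" "a' \<noteq> b'" by (auto simp: card_2_iff)
    then obtain a b where ab: "J = {a, b}" "a < b"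
      by (metis insert_commute linorder_neqE_nat)
    have sets: "{i \<in> J. i < a} = {}" "{i \<in> J. i < b} = {a}" "J - {a} = {b}" "J - {b} = {a}" using ab by auto
    have "cech_diff xs ?k J = (\<Sum>j\<in>{a, b}. (-1) ^ card {i \<in> J. i < j} * ?k (J - {j}))"
      using True ab(1) by (simp only: cech_diff_def if_True)
    also have "\<dots> = (-1) ^ card {i \<in> J. i < a} * ?k (J - {a}) + (-1) ^ card {i \<in> J. i < b} * ?k (J - {b})"
      using ab(2) by simp
    also have "\<dots> = 0" unfolding sets using ab(1) True by simp
    finally show ?thesis .
  next
    case False
    show ?thesis
    proof (cases "J \<subseteq> {..<length xs}")
      case True
      then have "card (J - {j}) \<noteq> 1" if "j \<in> J" for j
        using False that finite_subset[OF True] by (simp add: card_Diff_singleton)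
      then show ?thesis using True by (simp add: cech_diff_def)
    qed (simp add: cech_diff_def)
  qed
qed

text \<open>
  The situation of a two-dimensional monomial ring: only the first and the last generator, the two
  corners of the cone of exponents, have localizations smaller than the full group ring \<open>U\<close>.
\<close>

locale surface_cech =
  fixes A :: "'f::field set" and xs :: "'f list" and U :: "'f set"
  assumes two_gens: "length xs \<ge> 2"
    and loc_0: "I \<subseteq> {..<length xs} \<Longrightarrow> 0 \<in> localization_at A (\<Prod>i\<in>I. xs ! i)"
    and loc_minus: "I \<subseteq> {..<length xs} \<Longrightarrow> x \<in> localization_at A (\<Prod>i\<in>I. xs ! i) \<Longrightarrow>
      y \<in> localization_at A (\<Prod>i\<in>I. xs ! i) \<Longrightarrow> x - y \<in> localization_at A (\<Prod>i\<in>I. xs ! i)"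
    and loc_subset: "I \<subseteq> {..<length xs} \<Longrightarrow> localization_at A (\<Prod>i\<in>I. xs ! i) \<subseteq> U"
    and loc_interior: "I \<subseteq> {..<length xs} \<Longrightarrow> I \<noteq> {} \<Longrightarrow> I \<noteq> {0} \<Longrightarrow> I \<noteq> {length xs - 1} \<Longrightarrow>
      localization_at A (\<Prod>i\<in>I. xs ! i) = U"
begin

abbreviation loc :: "nat set \<Rightarrow> 'f set" where
  "loc I \<equiv> localization_at A (\<Prod>i\<in>I. xs ! i)"

abbreviation top :: nat where "top \<equiv> length xs - 1"

lemma xs_nonempty [simp]: "xs \<noteq> []"
  using two_gens by auto

lemma loc_empty: "loc {} = A"
  by (auto simp: localization_at_def)

lemma loc_ge_2:
  assumes "I \<subseteq> {..<length xs}" "card I \<ge> 2"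
  shows "loc I = U"
  using assms by (intro loc_interior) auto

lemma cochainD:
  assumes "c \<in> cech_cochains A xs p"
  shows "I \<subseteq> {..<length xs} \<Longrightarrow> card I = p \<Longrightarrow> c I \<in> loc I"
    and "\<not> I \<subseteq> {..<length xs} \<Longrightarrow> c I = 0" and "card I \<noteq> p \<Longrightarrow> c I = 0"
  using assms by (auto simp: cech_cochains_def dest: spec[of _ I])

lemma cochainI:
  assumes "\<And>I. I \<subseteq> {..<length xs} \<Longrightarrow> card I = p \<Longrightarrow> c I \<in> loc I"
    and "\<And>I. \<not> (I \<subseteq> {..<length xs} \<and> card I = p) \<Longrightarrow> c I = 0"
  shows "c \<in> cech_cochains A xs p"
  using assms by (simp add: cech_cochains_def)

lemma cocycleD:
  assumes "c \<in> cech_cocycles A xs p"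
  shows "c \<in> cech_cochains A xs p" "cech_diff xs c = (\<lambda>_. 0)"
  using assms by (auto simp: cech_cocycles_def)

lemma zero_cochain: "(\<lambda>_. 0) \<in> cech_cochains A xs p"
  by (auto intro: cochainI loc_0)

lemma zero_cocycle: "(\<lambda>_. 0) \<in> cech_cocycles A xs p"
  by (simp add: cech_cocycles_def zero_cochain cech_diff_zero)

lemma cochains_minus:
  assumes "c \<in> cech_cochains A xs p" "c' \<in> cech_cochains A xs p"
  shows "(\<lambda>I. c I - c' I) \<in> cech_cochains A xs p"
proof (rule cochainI)
  fix I assume "I \<subseteq> {..<length xs}" "card I = p"
  then show "c I - c' I \<in> loc I" using assms by (intro loc_minus cochainD(1))
next
  fix I assume "\<not> (I \<subseteq> {..<length xs} \<and> card I = p)"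
  then have "c I = 0" "c' I = 0" using cochainD(2,3)[OF assms(1), of I] cochainD(2,3)[OF assms(2), of I] by blast+
  then show "c I - c' I = 0" by simp
qed

lemma coboundaries_zero: "(\<lambda>_. 0) \<in> cech_coboundaries A xs p"
proof (cases p)
  case (Suc q)
  then show ?thesis
    using imageI[OF zero_cochain, of "cech_diff xs" q] by (simp add: cech_coboundaries_def cech_diff_zero)
qed (simp add: cech_coboundaries_def)

lemma coboundaries_minus:
  assumes "c \<in> cech_coboundaries A xs p" "c' \<in> cech_coboundaries A xs p"
  shows "(\<lambda>I. c I - c' I) \<in> cech_coboundaries A xs p"
proof (cases p)
  case 0
  then show ?thesis using assms by (simp add: cech_coboundaries_def)
next
  case (Suc q)
  then obtain h h' where h: "h \<in> cech_cochains A xs q" "c = cech_diff xs h"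
    and h': "h' \<in> cech_cochains A xs q" "c' = cech_diff xs h'"
    using assms by (auto simp: cech_coboundaries_def)
  have "(\<lambda>I. c I - c' I) = cech_diff xs (\<lambda>I. h I - h' I)"
    unfolding h(2) h'(2) cech_diff_minus ..
  then show ?thesis using Suc cochains_minus[OF h(1) h'(1)] by (simp add: cech_coboundaries_def)
qed

lemma class_zero_iff:
  assumes "c \<in> cech_cocycles A xs p"
  shows "cohomology_class A xs p c = cohomology_class A xs p (\<lambda>_. 0) \<longleftrightarrow> c \<in> cech_coboundaries A xs p"
proof
  assume eq: "cohomology_class A xs p c = cohomology_class A xs p (\<lambda>_. 0)"
  have "c \<in> cohomology_class A xs p c"
    using assms coboundaries_zero by (simp add: cohomology_class_def)
  then have "c \<in> cohomology_class A xs p (\<lambda>_. 0)" using eq by simp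
  then show "c \<in> cech_coboundaries A xs p" by (simp add: cohomology_class_def)
next
  assume c: "c \<in> cech_coboundaries A xs p"
  have "(\<lambda>I. c' I - c I) \<in> cech_coboundaries A xs p \<longleftrightarrow> c' \<in> cech_coboundaries A xs p" for c'
  proof
    assume *: "(\<lambda>I. c' I - c I) \<in> cech_coboundaries A xs p"
    have "(\<lambda>I. (c' I - c I) - (0 - c I)) \<in> cech_coboundaries A xs p"
      by (rule coboundaries_minus[OF * coboundaries_minus[OF coboundaries_zero c]])
    then show "c' \<in> cech_coboundaries A xs p" by simp
  qed (rule coboundaries_minus[OF _ c])
  then show "cohomology_class A xs p c = cohomology_class A xs p (\<lambda>_. 0)"
    by (simp add: cohomology_class_def)
qed

lemma deg_nonzero_iff:
  assumes "\<And>j. 0 \<in> gr j"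
  shows "local_cohomology_deg gr A xs p j \<noteq> {cohomology_class A xs p (\<lambda>_. 0)} \<longleftrightarrow>
    (\<exists>c\<in>cech_cocycles A xs p. (\<forall>I. c I \<in> gr j) \<and> c \<notin> cech_coboundaries A xs p)"
proof -
  let ?C = "{c \<in> cech_cocycles A xs p. \<forall>I. c I \<in> gr j}"
  have "cohomology_class A xs p ` ?C \<noteq> {cohomology_class A xs p (\<lambda>_. 0)} \<longleftrightarrow>
      (\<exists>c\<in>?C. cohomology_class A xs p c \<noteq> cohomology_class A xs p (\<lambda>_. 0))"
  proof -
    have "(\<lambda>_. 0) \<in> ?C" using zero_cocycle assms by simp
    then show ?thesis by (rule image_neq_singleton)
  qed
  also have "\<dots> \<longleftrightarrow> (\<exists>c\<in>?C. c \<notin> cech_coboundaries A xs p)"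
    by (intro bex_cong refl) (simp add: class_zero_iff)
  finally show ?thesis by (simp add: local_cohomology_deg_def Bex_def conj_assoc)
qed

lemma H0: "cech_cocycles A xs 0 = {\<lambda>_. 0}"
proof (intro equalityI subsetI)
  fix c assume c: "c \<in> cech_cocycles A xs 0"
  have "{0} \<subseteq> {..<length xs}" using two_gens by auto
  then have "cech_diff xs c {0} = c {}" by (simp add: cech_diff_def)
  then have "c {} = 0" using cocycleD(2)[OF c] by simp
  have "c I = 0" for I
  proof (cases "I \<subseteq> {..<length xs} \<and> card I = 0")
    case True
    then have "I = {}" using finite_subset by fastforce
    then show ?thesis using \<open>c {} = 0\<close> by simp
  qed (use cochainD(2,3)[OF cocycleD(1)[OF c]] in blast)
  then show "c \<in> {\<lambda>_. 0}" by auto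
qed (use zero_cocycle in simp)

definition constant_cochain :: "'f \<Rightarrow> nat set \<Rightarrow> 'f" where
  "constant_cochain x = (\<lambda>J. if card J = 1 \<and> J \<subseteq> {..<length xs} then x else 0)"

lemma constant_cochain_cocycle:
  assumes "x \<in> loc {0} \<inter> loc {top}"
  shows "constant_cochain x \<in> cech_cocycles A xs 1"
proof -
  have mem: "x \<in> loc I" if I: "I \<subseteq> {..<length xs}" "card I = 1" for I
  proof -
    obtain i where i: "I = {i}" using I(2) by (auto simp: card_1_singleton_iff)
    have "x \<in> U" using assms loc_subset[of "{0}"] by auto
    then have "x \<in> loc I" if "I \<noteq> {0}" "I \<noteq> {top}"
      using loc_interior[OF I(1)] i that by blast
    then show ?thesis using assms by blast
  qed
  have "constant_cochain x \<in> cech_cochains A xs 1"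
  proof (rule cochainI)
    fix I assume I: "I \<subseteq> {..<length xs}" "card I = 1"
    then show "constant_cochain x I \<in> loc I" using mem[OF I] by (simp add: constant_cochain_def)
  next
    fix I assume "\<not> (I \<subseteq> {..<length xs} \<and> card I = 1)"
    then show "constant_cochain x I = 0" unfolding constant_cochain_def by (simp only: conj_commute if_False)
  qed
  moreover have "cech_diff xs (constant_cochain x) = (\<lambda>_. 0)"
    unfolding constant_cochain_def by (rule cech_diff_constant_on_singletons)
  ultimately show ?thesis by (simp add: cech_cocycles_def)
qed

text \<open>
  The cocycle condition on \<open>{0, j}\<close> says that the values on \<open>{0}\<close> and \<open>{j}\<close> agree. Thus \<open>H\<^sup>1\<close> is the
  intersection of the two extreme localizations modulo \<open>A\<close>.
\<close>

lemma cocycle_1_constant: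
  assumes c: "c \<in> cech_cocycles A xs 1"
  obtains x where "x \<in> loc {0} \<inter> loc {top}" "c = constant_cochain x"
proof -
  note ch = cochainD[OF cocycleD(1)[OF c]]
  have eq: "c {j} = c {0}" if "0 < j" "j < length xs" for j
  proof -
    have J: "{0, j} \<subseteq> {..<length xs}" using that by auto
    have "cech_diff xs c {0, j} = 0" using cocycleD(2)[OF c] by simp
    moreover have "{i \<in> {0, j}. i < j} = {0}" "{0, j} - {0} = {j}" "{0, j} - {j} = {0}" using that by auto
    moreover have "cech_diff xs c {0, j} = (\<Sum>i\<in>{0, j}. (-1) ^ card {i' \<in> {0, j}. i' < i} * c ({0, j} - {i}))"
      using J by (simp only: cech_diff_def if_True)
    ultimately show ?thesis using that by simp
  qed
  have eq': "c {j} = c {0}" if "j < length xs" for j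
    using eq[of j] that by (cases "j = 0") auto
  have "c {0} \<in> loc {0}" using ch(1)[of "{0}"] two_gens by auto
  moreover have "c {top} \<in> loc {top}" using ch(1)[of "{top}"] two_gens by auto
  moreover have "c {top} = c {0}" by (rule eq') simp
  moreover have "c = constant_cochain (c {0})"
  proof
    fix I
    show "c I = constant_cochain (c {0}) I"
    proof (cases "card I = 1 \<and> I \<subseteq> {..<length xs}")
      case True
      then obtain i where "I = {i}" "i < length xs" by (auto simp: card_1_singleton_iff)
      then show ?thesis using True eq'[of i] by (simp add: constant_cochain_def)
    next
      case False
      then show ?thesis using ch(2,3)[of I] by (auto simp: constant_cochain_def)
    qed
  qed
  ultimately show ?thesis by (intro that[of "c {0}"]) (simp only: Int_iff)
qed

lemma constant_cochain_coboundary_iff: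
  "constant_cochain x \<in> cech_coboundaries A xs 1 \<longleftrightarrow> x \<in> A"
proof
  have s: "{0} \<subseteq> {..<length xs}" using two_gens by auto
  assume "constant_cochain x \<in> cech_coboundaries A xs 1"
  then obtain h where h: "h \<in> cech_cochains A xs 0" "constant_cochain x = cech_diff xs h"
    by (auto simp: cech_coboundaries_def)
  have "x = constant_cochain x {0}" using s by (simp add: constant_cochain_def)
  also have "\<dots> = h {}" unfolding h(2) using s by (simp add: cech_diff_def)
  finally show "x \<in> A" using cochainD(1)[OF h(1), of "{}"] loc_empty by simp
next
  assume x: "x \<in> A"
  define h where "h I = (if I = {} then x else 0)" for I :: "nat set"
  have h: "h \<in> cech_cochains A xs 0"
    using x loc_empty by (intro cochainI) (auto simp: h_def card_eq_0_iff finite_subset dest: finite_subset)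
  have "cech_diff xs h = constant_cochain x"
  proof
    fix J :: "nat set"
    consider "\<not> J \<subseteq> {..<length xs}" | j where "J = {j}" "j < length xs" | "J \<subseteq> {..<length xs}" "card J \<noteq> 1"
      by (metis card_1_singletonE insert_subset lessThan_iff)
    then show "cech_diff xs h J = constant_cochain x J"
    proof cases
      case 3
      then have "J - {j} \<noteq> {}" if "j \<in> J" for j
        using that by (metis Diff_eq_empty_iff card_1_singleton_iff empty_iff subset_singletonD One_nat_def)
      then show ?thesis using 3 by (simp add: cech_diff_def h_def constant_cochain_def)
    next
      case (2 j)
      have set: "{i \<in> J. i < j} = {}" using 2 by auto
      have "cech_diff xs h J = (\<Sum>i\<in>{j}. (-1) ^ card {i' \<in> J. i' < i} * h (J - {i}))"
        using 2 by (simp add: cech_diff_def)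
      also have "\<dots> = (-1) ^ card {i \<in> J. i < j} * h (J - {j})" by simp
      also have "\<dots> = x" unfolding set using 2 by (simp add: h_def)
      finally have "cech_diff xs h J = x" .
      then show ?thesis using 2 by (simp add: constant_cochain_def)
    qed (simp_all add: cech_diff_def constant_cochain_def)
  qed
  then show "constant_cochain x \<in> cech_coboundaries A xs 1"
    using imageI[OF h, of "cech_diff xs"] by (simp add: cech_coboundaries_def)
qed

text \<open>
  The contraction of \<open>c\<close> has the value \<open>c {0, top}\<close> on the last vertex, which need not lie in its
  localization. Subtracting the constant cochain \<open>y\<close>, whose coboundary is zero, changes this value to \<open>z\<close>
  and the value on the vertex \<open>0\<close> to \<open>- y\<close>; both are admissible.
\<close>

lemma H2_vanishes:
  assumes c: "c \<in> cech_cocycles A xs 2" and yz: "c {0, top} = y + z" "y \<in> loc {0}" "z \<in> loc {top}"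
  shows "c \<in> cech_coboundaries A xs 2"
proof -
  note ch = cochainD[OF cocycleD(1)[OF c]]
  define h where "h J = (if 0 \<in> J \<or> \<not> J \<subseteq> {..<length xs} then 0 else c (insert 0 J))" for J
  have xs: "xs \<noteq> []" using two_gens by auto
  have dh: "cech_diff xs h = c"
    unfolding h_def using cech_contraction[OF cocycleD(2)[OF c] ch(2) xs] by simp
  define g where "g J = h J - constant_cochain y J" for J
  have "cech_diff xs g = c"
    unfolding g_def cech_diff_minus dh constant_cochain_def cech_diff_constant_on_singletons by simp
  moreover have "g \<in> cech_cochains A xs 1"
  proof (rule cochainI)
    fix I assume I: "I \<subseteq> {..<length xs}" "card I = 1"
    then obtain i where i: "I = {i}" "i < length xs" by (auto simp: card_1_singleton_iff)
    have gI: "g I = h I - y" using I by (simp add: g_def constant_cochain_def)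
    have top0: "top \<noteq> 0" using two_gens by auto
    consider "i = 0" | "i = top" | "i \<noteq> 0" "i \<noteq> top" by blast
    then show "g I \<in> loc I"
    proof cases
      case 1
      then have "g I = 0 - y" using gI i by (simp add: h_def)
      then show ?thesis using loc_minus[OF I(1) loc_0[OF I(1)]] yz(2) i 1 by metis
    next
      case 2
      then have "g I = z" using gI i top0 yz(1) by (simp add: h_def)
      then show ?thesis using yz(3) i 2 by simp
    next
      case 3
      have J: "{0, i} \<subseteq> {..<length xs}" "card {0, i} = 2" using i 3 by auto
      have "h I = c {0, i}" using i 3 by (simp add: h_def)
      then have "h I \<in> U" using ch(1)[OF J] loc_subset[OF J(1)] by auto
      moreover have "loc I = U" using loc_interior[OF I(1)] i 3 by simp
      moreover have "y \<in> U" using yz(2) loc_subset[of "{0}"] two_gens by auto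
      ultimately show ?thesis using gI loc_minus[OF I(1)] by simp
    qed
  next
    fix I assume I: "\<not> (I \<subseteq> {..<length xs} \<and> card I = 1)"
    have "h I = 0"
    proof (cases "0 \<notin> I \<and> I \<subseteq> {..<length xs}")
      case True
      then have "card (insert 0 I) = Suc (card I)" using finite_subset by (intro card_insert_disjoint) auto
      then have "c (insert 0 I) = 0" using I True by (intro ch(3)) simp
      then show ?thesis by (simp add: h_def)
    qed (simp add: h_def)
    then show "g I = 0" using I by (auto simp: g_def constant_cochain_def)
  qed
  ultimately show ?thesis by (force simp: cech_coboundaries_def numeral_2_eq_2)
qed

text \<open>
  From two indices on, all localizations coincide, so the contraction always has admissible values.
\<close>

lemma H_ge_3_vanishes:
  assumes c: "c \<in> cech_cocycles A xs p" and p: "p \<ge> 3"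
  shows "c \<in> cech_coboundaries A xs p"
proof -
  obtain q where q: "p = Suc q" "q \<ge> 2" using p by (cases p) auto
  note ch = cochainD[OF cocycleD(1)[OF c]]
  define h where "h J = (if 0 \<in> J \<or> \<not> J \<subseteq> {..<length xs} then 0 else c (insert 0 J))" for J
  have xs: "xs \<noteq> []" using two_gens by auto
  have dh: "cech_diff xs h = c"
    unfolding h_def using cech_contraction[OF cocycleD(2)[OF c] ch(2) xs] by simp
  have ins: "insert 0 I \<subseteq> {..<length xs} \<and> card (insert 0 I) = Suc (card I)"
    if "0 \<notin> I" "I \<subseteq> {..<length xs}" for I
    using that two_gens finite_subset[OF that(2)] by auto
  have "h \<in> cech_cochains A xs q"
  proof (rule cochainI)
    fix I assume I: "I \<subseteq> {..<length xs}" "card I = q"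
    show "h I \<in> loc I"
    proof (cases "0 \<in> I")
      case True
      then show ?thesis using loc_0[OF I(1)] by (simp add: h_def)
    next
      case False
      then have "h I \<in> U"
        using ins[OF False I(1)] ch(1)[of "insert 0 I"] loc_subset[of "insert 0 I"] I q by (auto simp: h_def)
      then show ?thesis using loc_ge_2[OF I(1)] I(2) q by simp
    qed
  next
    fix I assume "\<not> (I \<subseteq> {..<length xs} \<and> card I = q)"
    then show "h I = 0" using ins[of I] ch(3)[of "insert 0 I"] q by (auto simp: h_def)
  qed
  then show ?thesis using dh q by (force simp: cech_coboundaries_def)
qed

end


section \<open>Ideals and submodules of subrings of a field\<close>

lemma type_ring: "ring (ring_of_type_algebra :: 'f::field ring)"
  by (rule ring_from_type_algebra)

lemma type_ring_simps [simp]: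
  "carrier ring_of_type_algebra = UNIV"
  "x \<otimes>\<^bsub>ring_of_type_algebra\<^esub> y = x * y" "x \<oplus>\<^bsub>ring_of_type_algebra\<^esub> y = x + y"
  "\<one>\<^bsub>ring_of_type_algebra\<^esub> = 1" "\<zero>\<^bsub>ring_of_type_algebra\<^esub> = 0"
  by (simp_all add: ring_of_type_algebra_def)

lemma type_ring_minus [simp]: "\<ominus>\<^bsub>ring_of_type_algebra\<^esub> (x :: 'f::field) = - x"
proof -
  interpret ring "ring_of_type_algebra :: 'f ring" by (rule type_ring)
  show ?thesis by (rule minus_equality) auto
qed

lemma ring_on_simps [simp]:
  "carrier (ring_on B) = B"
  "x \<otimes>\<^bsub>ring_on B\<^esub> y = x * y" "x \<oplus>\<^bsub>ring_on B\<^esub> y = x + y"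
  "\<one>\<^bsub>ring_on B\<^esub> = 1" "\<zero>\<^bsub>ring_on B\<^esub> = 0"
  by (simp_all add: ring_on_def ring_of_type_algebra_def)

lemma ring_on_ring:
  assumes "subring B (ring_of_type_algebra :: 'f::field ring)"
  shows "ring (ring_on B)"
proof -
  interpret ring "ring_of_type_algebra :: 'f ring" by (rule type_ring)
  show ?thesis using subring_iff[of B] assms by (simp add: ring_on_def)
qed

lemma ring_on_idealI:
  assumes "ring (ring_on B)" "I \<subseteq> B" "0 \<in> I" "\<And>x y. x \<in> I \<Longrightarrow> y \<in> I \<Longrightarrow> x + y \<in> I"
    and "\<And>x. x \<in> I \<Longrightarrow> - x \<in> I" "\<And>b x. b \<in> B \<Longrightarrow> x \<in> I \<Longrightarrow> b * x \<in> I"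
  shows "ideal I (ring_on B)"
proof (rule idealI)
  interpret ring "ring_on B" by fact
  show "subgroup I (add_monoid (ring_on B))"
  proof (rule add.subgroupI)
    fix x assume x: "x \<in> I"
    then have "\<ominus>\<^bsub>ring_on B\<^esub> x = - x"
      using assms(2,5) by (intro minus_equality) auto
    then show "\<ominus>\<^bsub>ring_on B\<^esub> x \<in> I" using x assms(5) by simp
  qed (use assms in auto)
  fix a x assume "a \<in> I" "x \<in> carrier (ring_on B)"
  then have "x * a \<in> I" using assms(6) by simp
  then show "x \<otimes>\<^bsub>ring_on B\<^esub> a \<in> I" "a \<otimes>\<^bsub>ring_on B\<^esub> x \<in> I"
    by (simp_all add: mult.commute)
qed (fact assms(1))

text \<open>
  Go up the composition series. For \<open>x \<in> C (i + 1)\<close> the submodule \<open>C i + z A x\<close> is one of its two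
  neighbours: either it is \<open>C i\<close>, and \<open>z x \<in> C i\<close>, or it is \<open>C (i + 1)\<close>, and \<open>(1 - z a) x \<in> C i\<close> for some
  \<open>a\<close>. Elements of the form \<open>z\<^sup>m (1 - z u)\<close> are closed under products.
\<close>

lemma composition_series_absorption:
  assumes A: "1 \<in> A" "\<And>x y. x \<in> A \<Longrightarrow> y \<in> A \<Longrightarrow> x - y \<in> A" "\<And>x y. x \<in> A \<Longrightarrow> y \<in> A \<Longrightarrow> x * y \<in> A"
    and z: "z \<in> A" and fl: "finite_length_quotient A M A'" and x: "x \<in> M"
  shows "\<exists>m. \<exists>u\<in>A. (z ^ m - z ^ Suc m * u) * x \<in> A'"
proof -
  obtain l :: nat and C where C: "C 0 = A'" "C l = M" "\<And>i. i \<le> l \<Longrightarrow> submodule_over A (C i)"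
    "\<And>i. i < l \<Longrightarrow> C i \<subset> C (Suc i)"
    "\<And>i L. i < l \<Longrightarrow> submodule_over A L \<Longrightarrow> C i \<subset> L \<Longrightarrow> L \<subset> C (Suc i) \<Longrightarrow> False"
    using fl unfolding finite_length_quotient_def by metis
  have zero: "0 \<in> A" using A(2)[OF A(1) A(1)] by simp
  have add: "a + b \<in> A" if "a \<in> A" "b \<in> A" for a b
    using A(2)[OF that(1) A(2)[OF zero that(2)]] by simp
  have "\<exists>m. \<exists>u\<in>A. (z ^ m - z ^ Suc m * u) * x \<in> A'" if "i \<le> l" "x \<in> C i" for i x
    using that
  proof (induction i arbitrary: x)
    case 0
    then show ?case using C(1) zero by (intro exI[of _ 0] bexI[of _ 0]) auto
  next
    case (Suc i)
    then have i: "i < l" by simp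
    have sub: "submodule_over A (C i)" "submodule_over A (C (Suc i))" using C(3) i by auto
    define L where "L = {c + z * a * x |c a. c \<in> C i \<and> a \<in> A}"
    have LI: "c + z * a * x \<in> L" if "c \<in> C i" "a \<in> A" for c a
      unfolding L_def using that by blast
    have "submodule_over A L"
      unfolding submodule_over_def
    proof (intro conjI ballI)
      show "0 \<in> L" using LI[of 0 0] zero sub(1) by (simp add: submodule_over_def)
    next
      fix v w assume "v \<in> L" "w \<in> L"
      then obtain c a c' a' where *: "v = c + z * a * x" "w = c' + z * a' * x" "c \<in> C i" "c' \<in> C i" "a \<in> A" "a' \<in> A"
        unfolding L_def by blast
      have "(c + c') + z * (a + a') * x \<in> L"
        using * sub(1) by (intro LI add) (auto simp: submodule_over_def)
      then show "v + w \<in> L" using * by (simp add: algebra_simps)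
    next
      fix b v assume "b \<in> A" "v \<in> L"
      then obtain c a where *: "v = c + z * a * x" "c \<in> C i" "a \<in> A"
        unfolding L_def by blast
      have "b * c + z * (b * a) * x \<in> L"
        using * sub(1) \<open>b \<in> A\<close> by (intro LI A) (auto simp: submodule_over_def)
      then show "b * v \<in> L" using * by (simp add: algebra_simps)
    qed
    moreover have "C i \<subseteq> L" using LI[OF _ zero] by auto
    moreover have "L \<subseteq> C (Suc i)"
      using sub(2) C(4)[OF i] Suc.prems(2) z A(3) unfolding L_def submodule_over_def by blast
    ultimately consider "L = C i" | "L = C (Suc i)" using C(5)[OF i, of L] by blast
    then show ?case
    proof cases
      case 1
      have "0 + z * 1 * x \<in> L" using sub(1) by (intro LI A) (simp add: submodule_over_def)
      then have "z * x \<in> C i" using 1 by simp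
      then obtain m u where mu: "u \<in> A" "(z ^ m - z ^ Suc m * u) * (z * x) \<in> A'" using Suc.IH i by force
      have "(z ^ Suc m - z ^ Suc (Suc m) * u) * x = (z ^ m - z ^ Suc m * u) * (z * x)"
        by (simp add: algebra_simps)
      then have "(z ^ Suc m - z ^ Suc (Suc m) * u) * x \<in> A'" using mu(2) by metis
      then show ?thesis using mu(1) by blast
    next
      case 2
      then obtain c a where ca: "x = c + z * a * x" "c \<in> C i" "a \<in> A"
        using Suc.prems(2) unfolding L_def by blast
      obtain m u where mu: "u \<in> A" "(z ^ m - z ^ Suc m * u) * c \<in> A'" using Suc.IH[OF _ ca(2)] i by force
      have c: "c = x - z * a * x" using ca(1) by (simp add: eq_diff_eq)
      have "(z ^ m - z ^ Suc m * u) * c = (z ^ m - z ^ Suc m * (u + (a - z * u * a))) * x"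
        unfolding c by (simp add: algebra_simps)
      moreover have "u + (a - z * u * a) \<in> A" using mu(1) ca(3) z by (intro add A)
      ultimately show ?thesis using mu(2) by metis
    qed
  qed
  then show ?thesis using C(2) x by blast
qed

section \<open>The monomial ring and its local cohomology\<close>

context two_parameters
begin

definition S' :: "(int \<times> int) set" where "S' = L\<^sub>X \<inter> L\<^sub>Y"

definition exps :: "nat list" where
  "exps = [0, b1 r, b2 r] @ map (a_exp r) [0..<n] @ [a_exp r n]"

abbreviation gen :: "nat \<Rightarrow> int \<times> int" where "gen e \<equiv> (D - int e, int e)"

lemma D_eq: "D = int (a_exp r n)"
  using r_ge_5 by (simp add: D_def a_exp_def)

lemma exps_set: "int ` set exps = E"
proof -
  have "int ` set (map (a_exp r) [0..<n] @ [a_exp r n]) = {2 * int r + 2 * i - 1 |i. 0 \<le> i \<and> i \<le> int n}"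
  proof (intro equalityI subsetI)
    fix x assume "x \<in> {2 * int r + 2 * i - 1 |i. 0 \<le> i \<and> i \<le> int n}"
    then obtain i where "x = 2 * int r + 2 * i - 1" "0 \<le> i" "i \<le> int n" by blast
    then have "x = int (a_exp r (nat i))" "nat i \<le> n" using r_ge_5 by (auto simp: a_exp_def)
    then show "x \<in> int ` set (map (a_exp r) [0..<n] @ [a_exp r n])" by (cases "nat i = n") auto
  next
    fix x assume "x \<in> int ` set (map (a_exp r) [0..<n] @ [a_exp r n])"
    then have "x \<in> (\<lambda>i. int (a_exp r i)) ` {..n}" by (auto simp: less_imp_le)
    then obtain i where "i \<le> n" "x = int (a_exp r i)" by blast
    then show "x \<in> {2 * int r + 2 * i - 1 |i. 0 \<le> i \<and> i \<le> int n}"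
      using r_ge_5 by (auto simp: a_exp_def intro!: exI[of _ "int i"])
  qed
  moreover have "int ` {0, b1 r, b2 r} = {0, int r, 2 * int r - 2}"
    using r_ge_5 by (auto simp: b1_def b2_def)
  moreover have "int ` set exps = int ` {0, b1 r, b2 r} \<union> int ` set (map (a_exp r) [0..<n] @ [a_exp r n])"
    by (auto simp: exps_def)
  ultimately show ?thesis by (simp only: E_def)
qed

lemma exps_le: "e \<in> set exps \<Longrightarrow> e \<le> a_exp r n"
  using E_bounds(2)[of "int e"] exps_set D_eq by auto

lemma gens_eq: "gens n r = (map (\<lambda>e. laurent (gen e)) exps :: 'k::field poly poly fract list)"
proof -
  have "laurent (gen e) = (monom_st (a_exp r n - e) e :: 'k poly poly fract)" if "e \<in> set exps" for e
    using exps_le[OF that] laurent_nat[of "a_exp r n - e" e] by (simp add: D_eq of_nat_diff)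
  then have "map (\<lambda>e. laurent (gen e)) exps = (map (\<lambda>e. monom_st (a_exp r n - e) e) exps :: 'k poly poly fract list)"
    by (intro map_cong refl) auto
  also have "\<dots> = gens n r" by (simp add: gens_def exps_def)
  finally show ?thesis by (rule sym)
qed

lemma exps_length: "length exps = n + 4"
  by (simp add: exps_def)

lemma exps_first: "exps ! 0 = 0"
  by (simp add: exps_def)

lemma exps_last: "exps ! (n + 3) = a_exp r n"
  by (simp add: exps_def nth_append)

lemma exps_interior:
  assumes "0 < i" "i < n + 3"
  shows "0 < int (exps ! i)" "int (exps ! i) < D"
proof -
  have "i = 1 \<or> i = 2 \<or> 3 \<le> i" using assms by linarith
  then consider "i = 1" | "i = 2" | j where "i = 3 + j" "j < n"
    using assms(2) by (metis add.commute add_less_cancel_right le_iff_add)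
  then have "0 < int (exps ! i) \<and> int (exps ! i) < D"
    by cases (use n_ge_1 r_ge_5 in \<open>auto simp: exps_def nth_append D_def b1_def b2_def a_exp_def\<close>)
  then show "0 < int (exps ! i)" "int (exps ! i) < D" by auto
qed

lemma S_ge_add: "g \<in> S_ge i \<Longrightarrow> h \<in> S_ge j \<Longrightarrow> g + h \<in> S_ge (i + j)"
proof -
  assume "g \<in> S_ge i" "h \<in> S_ge j"
  then obtain a b d a' b' d' where *: "g = (a, b)" "h = (a', b')" "i \<le> d" "j \<le> d'" "a + b = int d * D"
      "a' + b' = int d' * D" "b \<in> sumset d" "b' \<in> sumset d'"
    by (auto simp: S_ge_def)
  have "b + b' \<in> sumset (d + d')" using * by (intro sumset_add)
  moreover have "(a + a') + (b + b') = int (d + d') * D" using *(5,6) by (simp add: distrib_right)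
  ultimately show ?thesis using * unfolding S_ge_def by (auto intro!: exI[of _ "d + d'"])
qed

lemma S_ge_subset: "i \<le> j \<Longrightarrow> S_ge j \<subseteq> S_ge i"
  unfolding S_ge_def using order_trans by blast

lemma zero_in_S: "0 \<in> S"
  by (auto simp: S_ge_def zero_prod_def intro!: exI[of _ 0])

lemma gen_in_S: "e \<in> set exps \<Longrightarrow> gen e \<in> S_ge 1"
  using exps_set sumset_1[of "int e"] unfolding S_ge_def by fastforce

lemma S_subset_S': "S \<subseteq> S'"
  unfolding S'_def
proof
  fix g assume "g \<in> S"
  then obtain a b where g: "g = (a, b)" "(a, b) \<in> S" by (cases g) auto
  have "(a, b) \<in> L\<^sub>X" using localize_X[of a b] g(2) by (metis add_0_right mult_zero_left of_nat_0)
  moreover have "(a, b) \<in> L\<^sub>Y" using localize_Y[of a b] g(2) by (metis add_0_right mult_zero_left of_nat_0)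
  ultimately show "g \<in> L\<^sub>X \<inter> L\<^sub>Y" using g by simp
qed

lemma G_add: "g \<in> G \<Longrightarrow> h \<in> G \<Longrightarrow> g + h \<in> G"
proof (cases g; cases h)
  fix a b a' b' assume *: "g \<in> G" "h \<in> G" "g = (a, b)" "h = (a', b')"
  then have "D dvd a + b" "D dvd a' + b'" by (simp_all add: G_def)
  then have "D dvd (a + b) + (a' + b')" by (rule dvd_add)
  then have "D dvd (a + a') + (b + b')" by (simp only: add.assoc add.left_commute)
  then show "g + h \<in> G" using * by (simp add: G_def)
qed

lemma S'_iff: "(a, b) \<in> S' \<longleftrightarrow> (a, b) \<in> G \<and> a \<in> \<Gamma>\<^sub>s \<and> b \<in> \<Gamma>\<^sub>t"
  by (auto simp: S'_def L\<^sub>X_def L\<^sub>Y_def G_def)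

lemma S'_add: "g \<in> S' \<Longrightarrow> h \<in> S' \<Longrightarrow> g + h \<in> S'"
proof (cases g; cases h)
  fix a b a' b' assume *: "g \<in> S'" "h \<in> S'" "g = (a, b)" "h = (a', b')"
  then show "g + h \<in> S'" using G_add[of g h] \<Gamma>\<^sub>s_add \<Gamma>\<^sub>t_add by (simp add: S'_iff)
qed

lemma S'_subset_G: "S' \<subseteq> G"
  by (auto simp: S'_def L\<^sub>X_def G_def)

text \<open>
  The exponents of \<open>(s\<^sup>D\<^sup>-\<^sup>r t\<^sup>r)\<^sup>3 (t\<^sup>D)\<^sup>j / s\<^sup>D\<close>.
\<close>

definition exceptional :: "nat \<Rightarrow> int \<times> int" where
  "exceptional j = (int r + 4 * int n - 2, 3 * int r + int j * D)"

lemma exceptional_degree: "fst (exceptional j) + snd (exceptional j) = int (j + 2) * D"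
  by (simp add: exceptional_def D_def algebra_simps)

lemma exceptional_in_S': "exceptional j \<in> S'"
proof -
  have r: "int r \<in> \<Gamma>\<^sub>t" using E_basic E_subset_\<Gamma>\<^sub>t by auto
  have "int j * D \<in> \<Gamma>\<^sub>t" using sumset_D by (auto simp: \<Gamma>\<^sub>t_def)
  then have "int r + (int r + (int r + int j * D)) \<in> \<Gamma>\<^sub>t" by (intro \<Gamma>\<^sub>t_add r)
  then have "3 * int r + int j * D \<in> \<Gamma>\<^sub>t" by (simp add: algebra_simps)
  moreover have "int r + 4 * int n - 2 \<in> \<Gamma>\<^sub>s" using r_bound n_pos by (simp add: \<Gamma>\<^sub>s_def)
  moreover have "D dvd (int r + 4 * int n - 2) + (3 * int r + int j * D)"
    using exceptional_degree[of j] unfolding exceptional_def by (metis dvd_triv_right fst_conv snd_conv)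
  ultimately show ?thesis by (simp add: S'_def L\<^sub>X_def L\<^sub>Y_def exceptional_def)
qed

lemma exceptional_in_S_iff: "exceptional j \<in> S \<longleftrightarrow> 3 * int r + int j * D \<in> sumset (j + 2)"
proof
  assume "exceptional j \<in> S"
  then obtain d where d: "fst (exceptional j) + snd (exceptional j) = int d * D" "snd (exceptional j) \<in> sumset d"
    by (force simp: S_ge_def)
  then have "int d = int (j + 2)" using exceptional_degree[of j] D_pos by simp
  then have "d = j + 2" by linarith
  then show "3 * int r + int j * D \<in> sumset (j + 2)" using d(2) by (simp add: exceptional_def)
next
  assume "3 * int r + int j * D \<in> sumset (j + 2)"
  then have "fst (exceptional j) + snd (exceptional j) = int (j + 2) * D \<and> snd (exceptional j) \<in> sumset (j + 2)"
    using exceptional_degree[of j] by (simp add: exceptional_def)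
  then have "\<exists>d\<ge>0. fst (exceptional j) + snd (exceptional j) = int d * D \<and> snd (exceptional j) \<in> sumset d"
    by (intro exI[of _ "j + 2"] conjI) auto
  then show "exceptional j \<in> S" by (simp only: S_ge_def case_prod_beta mem_Collect_eq)
qed

lemma exceptional_mono: "exceptional i \<in> S \<Longrightarrow> i \<le> j \<Longrightarrow> exceptional j \<in> S"
proof -
  assume i: "exceptional i \<in> S" "i \<le> j"
  have "(3 * int r + int i * D) + int (j - i) * D \<in> sumset (i + 2 + (j - i))"
    using i(1) unfolding exceptional_in_S_iff by (rule sumset_add[OF _ sumset_D])
  moreover have "(3 * int r + int i * D) + int (j - i) * D = 3 * int r + int j * D"
    using i(2) by (simp add: of_nat_diff algebra_simps)
  moreover have "i + 2 + (j - i) = j + 2" using i(2) by simp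
  ultimately show ?thesis unfolding exceptional_in_S_iff by metis
qed

lemma S'_cases:
  assumes "g \<in> S'"
  obtains "g \<in> S" | j where "g = exceptional j"
  using saturation_cases[of "fst g" "snd g"] assms unfolding S'_def exceptional_def
  by (metis prod.collapse)

lemma S_degree: "g \<in> S_ge i \<Longrightarrow> \<exists>d\<ge>i. fst g + snd g = int d * D"
  by (auto simp: S_ge_def)

text \<open>
  Adding an element of degree at least \<open>i\<close> to \<open>exceptional j\<close> leads to \<open>S\<close> or to some
  \<open>exceptional j'\<close> with \<open>j' \<ge> i + j\<close>, by comparing degrees.
\<close>

lemma S_ge_plus_S':
  assumes i: "exceptional i \<in> S" and g: "g \<in> S_ge i" and h: "h \<in> S'"
  shows "g + h \<in> S"
  using h
proof (cases rule: S'_cases)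
  case 1
  then show ?thesis using S_ge_add[OF g, of h 0] S_ge_subset by auto
next
  case (2 j)
  have "g + h \<in> S'" using S'_add S_subset_S' S_ge_subset[of 0 i] g h by blast
  then show ?thesis
  proof (cases rule: S'_cases)
    case (2 j')
    obtain d where d: "d \<ge> i" "fst g + snd g = int d * D" using S_degree[OF g] by blast
    have "int (j' + 2) * D = (fst g + snd g) + (fst h + snd h)"
      using exceptional_degree[of j'] 2 by (metis fst_add snd_add add.assoc add.left_commute)
    also have "\<dots> = (int d + int (j + 2)) * D"
      using d exceptional_degree[of j] \<open>h = exceptional j\<close> by (simp add: distrib_right)
    finally have "int (j' + 2) = int d + int (j + 2)" using D_pos by simp
    then have "i \<le> j'" using d(1) by linarith
    then show ?thesis using exceptional_mono[OF i] 2 by simp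
  qed
qed

lemma S'_high_degree:
  assumes k: "exceptional k \<in> S" and g: "g \<in> S'" "fst g + snd g = j * D" "j \<ge> int k + 2"
  shows "g \<in> S"
  using g(1)
proof (cases rule: S'_cases)
  case (2 j')
  then have "j = int (j' + 2)" using g(2) exceptional_degree[of j'] D_pos by simp
  then have "k \<le> j'" using g(3) by linarith
  then show ?thesis using exceptional_mono[OF k] 2 by simp
qed

lemma laurent_in_mspan_iff: "laurent g \<in> mspan T \<longleftrightarrow> g \<in> T"
proof
  assume *: "laurent g \<in> mspan T"
  have "laurent g \<in> mspan {g}" by (rule mspan_laurent1) simp
  then show "g \<in> T" using mspan_disjoint[OF *, of "{g}"] laurent_nonzero[of g] by blast
qed (rule mspan_laurent1)

lemma S_mspan_mult: "x \<in> mspan S \<Longrightarrow> y \<in> mspan S \<Longrightarrow> x * y \<in> mspan S"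
  by (rule mspan_mult) (use S_ge_add[of _ 0 _ 0] in auto)

lemma one_in_mspan_S: "1 \<in> mspan S"
  using mspan_laurent1[OF zero_in_S] by simp

lemma monomial_ring_eq: "monomial_ring n r = (mspan S :: 'k::field poly poly fract set)"
proof -
  let ?T = "ring_of_type_algebra :: 'k poly poly fract ring"
  interpret T: ring ?T by (rule type_ring)
  have "generate_ring ?T (range const_st \<union> set (gens n r)) \<subseteq> mspan S"
  proof (rule T.generate_ring_min_subring1)
    show "subring (mspan S) ?T"
      by (rule T.subringI) (auto intro: one_in_mspan_S mspan_uminus mspan_add S_mspan_mult)
    have "const_st c \<in> mspan S" for c :: 'k using mspan_laurent[OF zero_in_S, of c] by simp
    moreover have "laurent (gen e) \<in> (mspan S :: 'k poly poly fract set)" if "e \<in> set exps" for e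
      using gen_in_S[OF that] S_ge_subset[of 0 1] by (intro mspan_laurent1) auto
    ultimately show "range const_st \<union> set (gens n r) \<subseteq> (mspan S :: 'k poly poly fract set)"
      by (auto simp: gens_eq)
  qed auto
  moreover have "mspan S \<subseteq> generate_ring ?T (range const_st \<union> set (gens n r))" (is "_ \<subseteq> ?R")
  proof
    fix x :: "'k poly poly fract" assume "x \<in> mspan S"
    then obtain F c where F: "finite F" "F \<subseteq> S" "x = (\<Sum>g\<in>F. const_st (c g) * laurent g)" by (rule mspanE)
    have mult: "u * v \<in> ?R" if "u \<in> ?R" "v \<in> ?R" for u v
      using generate_ring.eng_mult[OF that] by simp
    have add: "u + v \<in> ?R" if "u \<in> ?R" "v \<in> ?R" for u v
      using generate_ring.eng_add[OF that] by simp
    have mon: "laurent (int d * D - b, b) \<in> ?R" if "b \<in> sumset d" for d b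
      using that
    proof (induction d arbitrary: b)
      case 0
      then have "laurent (int 0 * D - b, b) = (1 :: 'k poly poly fract)" using laurent_0 by (simp add: zero_prod_def)
      then show ?case using generate_ring.one[of ?T] by simp
    next
      case (Suc d)
      then obtain e y where ey: "e \<in> E" "y \<in> sumset d" "b = e + y" by (auto elim: sumset_SucE)
      then obtain e' where e': "e' \<in> set exps" "e = int e'" using exps_set by blast
      have "laurent (gen e') \<in> (set (gens n r) :: 'k poly poly fract set)" using e' by (simp add: gens_eq)
      then have "laurent (gen e') \<in> ?R" by (intro generate_ring.incl) simp
      then have "laurent (gen e') * laurent (int d * D - y, y) \<in> ?R" using Suc.IH[OF ey(2)] mult by blast
      also have "laurent (gen e') * laurent (int d * D - y, y) = (laurent (gen e' + (int d * D - y, y)) :: 'k poly poly fract)"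
        by (simp only: laurent_add)
      also have "gen e' + (int d * D - y, y) = (int (Suc d) * D - b, b)"
        using ey e' by (simp add: algebra_simps)
      finally show ?case .
    qed
    have "laurent g \<in> ?R" if "g \<in> S" for g
    proof -
      obtain d where d: "fst g + snd g = int d * D" "snd g \<in> sumset d"
        using \<open>g \<in> S\<close> by (force simp: S_ge_def)
      have "g = (int d * D - snd g, snd g)" using d(1) by (cases g) auto
      then show ?thesis using mon[OF d(2)] by simp
    qed
    then have summand: "const_st (c g) * laurent g \<in> ?R" if "g \<in> F" for g
    proof -
      have "laurent g \<in> ?R" using \<open>\<And>g. g \<in> S \<Longrightarrow> laurent g \<in> ?R\<close> that F(2) by blast
      moreover have "const_st (c g) \<in> ?R" by (intro generate_ring.incl) simp
      ultimately show ?thesis by (intro mult)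
    qed
    have "0 \<in> ?R" using T.zero_in_generate by simp
    have "(\<Sum>g\<in>F'. const_st (c g) * laurent g) \<in> ?R" if "finite F'" "F' \<subseteq> F" for F'
      using that by (induction F' rule: finite_induct) (auto intro: \<open>0 \<in> ?R\<close> add summand)
    then show "x \<in> ?R" using F(1,3) by blast
  qed
  ultimately show ?thesis unfolding monomial_ring_def by blast
qed


definition vec :: "nat set \<Rightarrow> int \<times> int" where "vec I = (\<Sum>i\<in>I. gen (exps ! i))"

lemma gens_length: "length (gens n r) = n + 4"
  by (simp add: gens_eq exps_length)

lemma gens_top: "length (gens n r) - 1 = n + 3"
  by (simp add: gens_length)

lemma prod_gens:
  assumes "I \<subseteq> {..<n + 4}"
  shows "(\<Prod>i\<in>I. gens n r ! i) = (laurent (vec I) :: 'k::field poly poly fract)"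
proof -
  have "(\<Prod>i\<in>I. gens n r ! i) = (\<Prod>i\<in>I. laurent (gen (exps ! i)) :: 'k poly poly fract)"
    using assms by (intro prod.cong refl) (auto simp: gens_eq exps_length)
  then show ?thesis using laurent_prod finite_subset[OF assms] by (simp add: vec_def)
qed

lemma vec_in_S:
  assumes "I \<subseteq> {..<n + 4}"
  shows "vec I \<in> S"
proof -
  have "(\<Sum>i\<in>J. gen (exps ! i)) \<in> S" if "finite J" "J \<subseteq> I" for J
    using that
  proof (induction J rule: finite_induct)
    case empty
    then show ?case using zero_in_S by simp
  next
    case (insert i J)
    then have "exps ! i \<in> set exps" using assms by (auto simp: exps_length)
    then have "gen (exps ! i) \<in> S" using gen_in_S S_ge_subset[of 0 1] by blast
    moreover have "(\<Sum>i\<in>J. gen (exps ! i)) \<in> S" using insert by simp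
    ultimately have "gen (exps ! i) + (\<Sum>i\<in>J. gen (exps ! i)) \<in> S_ge (0 + 0)" by (rule S_ge_add)
    then show ?case using insert(1,2) by (simp only: sum.insert add_0_left not_False_eq_True)
  qed
  then show ?thesis using finite_subset[OF assms] by (simp add: vec_def)
qed

lemma loc_eq:
  assumes "I \<subseteq> {..<n + 4}"
  shows "localization_at (mspan S) (\<Prod>i\<in>I. gens n r ! i) = (mspan {g. \<exists>N. (fst g + int N * fst (vec I),
    snd g + int N * snd (vec I)) \<in> S} :: 'k::field poly poly fract set)"
  unfolding prod_gens[OF assms]
  by (rule localization_mspan) (use S_ge_add[of _ 0 _ 0] vec_in_S[OF assms] in auto)

lemma loc_X: "localization_at (mspan S) (laurent (D, 0)) = (mspan L\<^sub>X :: 'k::field poly poly fract set)"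
proof -
  have "(D, 0) \<in> S" using gen_in_S[of 0] S_ge_subset[of 0 1] by (auto simp: exps_def)
  then have "localization_at (mspan S) (laurent (D, 0)) = (mspan {g. \<exists>N. (fst g + int N * fst (D, 0 :: int),
      snd g + int N * snd (D, 0 :: int)) \<in> S} :: 'k poly poly fract set)"
    by (intro localization_mspan) (use S_ge_add[of _ 0 _ 0] in auto)
  also have "{g. \<exists>N. (fst g + int N * fst (D, 0 :: int), snd g + int N * snd (D, 0 :: int)) \<in> S} = L\<^sub>X"
    using localize_X by auto
  finally show ?thesis .
qed

lemma loc_Y: "localization_at (mspan S) (laurent (0, D)) = (mspan L\<^sub>Y :: 'k::field poly poly fract set)"
proof -
  have "gen (a_exp r n) \<in> S_ge 1" by (rule gen_in_S) (simp add: exps_def)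
  then have "(0, D) \<in> S" using S_ge_subset[of 0 1] by (auto simp: D_eq)
  then have "localization_at (mspan S) (laurent (0, D)) = (mspan {g. \<exists>N. (fst g + int N * fst (0 :: int, D),
      snd g + int N * snd (0 :: int, D)) \<in> S} :: 'k poly poly fract set)"
    by (intro localization_mspan) (use S_ge_add[of _ 0 _ 0] in auto)
  also have "{g. \<exists>N. (fst g + int N * fst (0 :: int, D), snd g + int N * snd (0 :: int, D)) \<in> S} = L\<^sub>Y"
    using localize_Y by auto
  finally show ?thesis .
qed

lemma vec_positive:
  assumes I: "I \<subseteq> {..<n + 4}" "I \<noteq> {}" "I \<noteq> {0}" "I \<noteq> {n + 3}"
  shows "fst (vec I) > 0" "snd (vec I) > 0"
proof -
  have fin: "finite I" using I(1) finite_subset by blast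
  have nonneg: "0 \<le> int (exps ! i)" "int (exps ! i) \<le> D" if "i \<in> I" for i
  proof -
    have "i < length exps" using that I(1) exps_length by auto
    then have "exps ! i \<le> a_exp r n" by (rule exps_le[OF nth_mem])
    then show "0 \<le> int (exps ! i)" "int (exps ! i) \<le> D" unfolding D_eq by simp_all
  qed
  have "\<not> I \<subseteq> {n + 3}" using I(2,4) by (simp add: subset_singleton_iff)
  then obtain i where i: "i \<in> I" "i \<noteq> n + 3" by blast
  moreover have "i < n + 4" using i(1) I(1) by blast
  ultimately consider "i = 0" | "0 < i" "i < n + 3" by linarith
  then have "int (exps ! i) < D"
    by cases (use exps_first D_pos exps_interior(2)[of i] in simp_all)
  then have "0 < (\<Sum>i\<in>I. D - int (exps ! i))"
    using nonneg by (intro sum_pos2[OF fin i(1)]) simp_all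
  then show "fst (vec I) > 0" by (simp add: vec_def fst_sum)
  have "\<not> I \<subseteq> {0}" using I(2,3) by (simp add: subset_singleton_iff)
  then obtain j where j: "j \<in> I" "j \<noteq> 0" by blast
  moreover have "j < n + 4" using j(1) I(1) by blast
  ultimately have "j = n + 3 \<or> j < n + 3 \<and> 0 < j" by linarith
  then have "0 < int (exps ! j)"
  proof
    assume "j = n + 3"
    then have "int (exps ! j) = D" by (simp only: exps_last D_eq)
    then show ?thesis using D_pos by simp
  next
    assume "j < n + 3 \<and> 0 < j"
    then show ?thesis by (intro exps_interior(1)) auto
  qed
  then have "0 < (\<Sum>i\<in>I. int (exps ! i))"
    using nonneg by (intro sum_pos2[OF fin j(1)]) simp_all
  then show "snd (vec I) > 0" by (simp add: vec_def snd_sum)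
qed

lemma S_subset_G: "S \<subseteq> G"
  using S_subset_S' S'_subset_G by blast

lemma surface_cech_gens: "surface_cech (mspan S :: 'k::field poly poly fract set) (gens n r) (mspan G)"
proof
  show "2 \<le> length (gens n r :: 'k poly poly fract list)" by (simp add: gens_length)
next
  fix I :: "nat set" assume "I \<subseteq> {..<length (gens n r :: 'k poly poly fract list)}"
  then have I: "I \<subseteq> {..<n + 4}" by (simp add: gens_length)
  note loc = loc_eq[OF I, where 'k='k]
  show "0 \<in> localization_at (mspan S) (\<Prod>i\<in>I. gens n r ! i :: 'k poly poly fract)"
    unfolding loc by simp
  show "x - y \<in> localization_at (mspan S) (\<Prod>i\<in>I. gens n r ! i)"
    if "x \<in> localization_at (mspan S) (\<Prod>i\<in>I. gens n r ! i)" "y \<in> localization_at (mspan S) (\<Prod>i\<in>I. gens n r ! i)"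
    for x y :: "'k poly poly fract"
    using that unfolding loc by (rule mspan_diff)
  have sub: "{g. \<exists>N. (fst g + int N * fst (vec I), snd g + int N * snd (vec I)) \<in> S} \<subseteq> G"
  proof safe
    fix a b N assume "(fst (a, b) + int N * fst (vec I), snd (a, b) + int N * snd (vec I)) \<in> S"
    then have "D dvd (a + b) + int N * (fst (vec I) + snd (vec I))"
      using S_subset_G by (auto simp: G_def algebra_simps)
    moreover have "D dvd fst (vec I) + snd (vec I)"
      using vec_in_S[OF I] S_subset_G by (auto simp: G_def)
    ultimately have "D dvd a + b" by (metis dvd_add_left_iff dvd_mult)
    then show "(a, b) \<in> G" by (simp add: G_def)
  qed
  show "localization_at (mspan S) (\<Prod>i\<in>I. gens n r ! i) \<subseteq> (mspan G :: 'k poly poly fract set)"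
    unfolding loc by (rule mspan_mono[OF sub])
  assume ne: "I \<noteq> {}" "I \<noteq> {0}" "I \<noteq> {length (gens n r :: 'k poly poly fract list) - 1}"
  have "I \<noteq> {n + 3}" using ne(3) unfolding gens_top .
  then have pos: "fst (vec I) > 0" "snd (vec I) > 0" using vec_positive[OF I ne(1,2)] by blast+
  have "vec I \<in> G" using vec_in_S[OF I] S_subset_G by blast
  then have "G \<subseteq> {g. \<exists>N. (fst g + int N * fst (vec I), snd g + int N * snd (vec I)) \<in> S}"
    using localize_interior[of _ _ "fst (vec I)" "snd (vec I)"] pos by auto
  then show "localization_at (mspan S) (\<Prod>i\<in>I. gens n r ! i) = (mspan G :: 'k poly poly fract set)"
    unfolding loc using sub by (intro arg_cong[of _ _ mspan]) blast
qed

lemma loc_ends: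
  "localization_at (mspan S) (\<Prod>i\<in>{0}. gens n r ! i) = (mspan L\<^sub>X :: 'k::field poly poly fract set)"
  "localization_at (mspan S) (\<Prod>i\<in>{length (gens n r :: 'k poly poly fract list) - 1}. gens n r ! i)
     = (mspan L\<^sub>Y :: 'k poly poly fract set)"
proof -
  have "gens n r ! 0 = (laurent (D, 0) :: 'k poly poly fract)"
    by (simp add: gens_eq exps_length exps_first)
  moreover have "gens n r ! (n + 3) = (laurent (0, D) :: 'k poly poly fract)"
    by (simp add: gens_eq exps_length exps_last D_eq)
  ultimately show "localization_at (mspan S) (\<Prod>i\<in>{0}. gens n r ! i) = (mspan L\<^sub>X :: 'k::field poly poly fract set)"
    "localization_at (mspan S) (\<Prod>i\<in>{length (gens n r :: 'k poly poly fract list) - 1}. gens n r ! i)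
     = (mspan L\<^sub>Y :: 'k poly poly fract set)"
    unfolding gens_top by (simp_all only: loc_X loc_Y prod.insert[OF finite.emptyI] prod.empty empty_iff not_False_eq_True mult_1_right)
qed

lemma mspan_S': "mspan S' = mspan L\<^sub>X \<inter> mspan L\<^sub>Y"
  using mspan_mono[of S' L\<^sub>X] mspan_mono[of S' L\<^sub>Y] mspan_Int unfolding S'_def by blast

lemma annihilates_iff:
  assumes J: "J \<subseteq> (mspan S :: 'k::field poly poly fract set)"
  shows "annihilates_local_cohomology J (mspan S) (gens n r) 1 \<longleftrightarrow> (\<forall>a\<in>J. \<forall>x\<in>mspan S'. a * x \<in> mspan S)"
proof -
  interpret surface_cech "mspan S :: 'k poly poly fract set" "gens n r" "mspan G"
    by (rule surface_cech_gens)
  have scale: "(\<lambda>I. a * constant_cochain x I) = constant_cochain (a * x)" for a x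
    by (rule ext) (simp add: constant_cochain_def)
  have ends: "loc {0} \<inter> loc {length (gens n r :: 'k poly poly fract list) - 1} = mspan S'"
    unfolding loc_ends mspan_S' ..
  have cocycle: "constant_cochain x \<in> cech_cocycles (mspan S) (gens n r) 1" if "x \<in> mspan S'" for x
    using that ends by (intro constant_cochain_cocycle) simp
  have iff: "cohomology_class (mspan S) (gens n r) 1 (\<lambda>I. a * constant_cochain x I) =
      cohomology_class (mspan S) (gens n r) 1 (\<lambda>_. 0) \<longleftrightarrow> a * x \<in> mspan S"
    if "a \<in> J" "x \<in> mspan S'" for a x
  proof -
    have "a \<in> mspan S" using that(1) J by blast
    then have "a * x \<in> mspan S'"
      using that(2) by (rule mspan_mult) (use S_subset_S' in \<open>auto intro: S'_add\<close>)
    from class_zero_iff[OF cocycle[OF this]] show ?thesis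
      unfolding scale constant_cochain_coboundary_iff .
  qed
  show ?thesis
  proof (intro iffI ballI)
    fix a x :: "'k poly poly fract"
    assume *: "annihilates_local_cohomology J (mspan S) (gens n r) 1" "a \<in> J" "x \<in> mspan S'"
    from cocycle[OF *(3)] show "a * x \<in> mspan S" using * iff unfolding annihilates_local_cohomology_def by blast
  next
    assume *: "\<forall>a\<in>J. \<forall>x\<in>mspan S'. a * x \<in> mspan S"
    show "annihilates_local_cohomology J (mspan S) (gens n r) 1"
      unfolding annihilates_local_cohomology_def
    proof (intro ballI)
      fix a :: "'k poly poly fract" and c :: "nat set \<Rightarrow> 'k poly poly fract"
      assume a: "a \<in> J" and c: "c \<in> cech_cocycles (mspan S) (gens n r) 1"
      from c obtain x where "x \<in> loc {0} \<inter> loc {length (gens n r :: 'k poly poly fract list) - 1}" "c = constant_cochain x"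
        by (rule cocycle_1_constant)
      then show "cohomology_class (mspan S) (gens n r) 1 (\<lambda>I. a * c I) =
          cohomology_class (mspan S) (gens n r) 1 (\<lambda>_. 0)"
        using iff[OF a, of x] a * ends by auto
    qed
  qed
qed

lemma ring_mspan_S: "ring (ring_on (mspan S :: 'k::field poly poly fract set))"
proof (rule ring_on_ring)
  interpret T: ring "ring_of_type_algebra :: 'k poly poly fract ring" by (rule type_ring)
  show "subring (mspan S) (ring_of_type_algebra :: 'k poly poly fract ring)"
    by (rule T.subringI) (auto intro: one_in_mspan_S mspan_uminus mspan_add S_mspan_mult)
qed

abbreviation max_ideal :: "'k::field poly poly fract set" where
  "max_ideal \<equiv> Idl\<^bsub>ring_on (mspan S)\<^esub> (set (gens n r))"

lemma gens_in_mspan: "set (gens n r) \<subseteq> (mspan (S_ge 1) :: 'k::field poly poly fract set)"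
  using gen_in_S by (auto simp: gens_eq intro: mspan_laurent1)

lemma ideal_power_subset: "ideal_power (ring_on (mspan S)) max_ideal i \<subseteq> (mspan (S_ge i) :: 'k::field poly poly fract set)"
proof (induction i)
  case 0
  then show ?case by (simp add: ideal_power_def)
next
  case (Suc i)
  interpret ring "ring_on (mspan S :: 'k poly poly fract set)" by (rule ring_mspan_S)
  have "ideal (mspan (S_ge 1)) (ring_on (mspan S :: 'k poly poly fract set))"
  proof (rule ring_on_idealI[OF ring_mspan_S])
    show "b * x \<in> mspan (S_ge 1)" if "b \<in> mspan S" "x \<in> mspan (S_ge 1)" for b x :: "'k poly poly fract"
      using that by (rule mspan_mult) (use S_ge_add[of _ 0 _ 1] in auto)
  qed (auto intro: mspan_add mspan_uminus mspan_mono[THEN subsetD, OF S_ge_subset])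
  then have m: "max_ideal \<subseteq> (mspan (S_ge 1) :: 'k poly poly fract set)"
    by (rule genideal_minimal[OF _ gens_in_mspan])
  have "x \<in> mspan (S_ge (Suc i))"
    if "x \<in> ideal_prod (ring_on (mspan S)) max_ideal (ideal_power (ring_on (mspan S)) max_ideal i)"
    for x :: "'k poly poly fract"
    using that
  proof (induction rule: ideal_prod.induct)
    case (prod a b)
    then have "a \<in> mspan (S_ge 1)" "b \<in> mspan (S_ge i)" using m Suc by auto
    then have "a * b \<in> mspan (S_ge (Suc i))"
      by (rule mspan_mult) (use S_ge_add[of _ 1 _ i] in auto)
    then show ?case by simp
  qed (auto intro: mspan_add)
  then show ?case by (auto simp: ideal_power_def)
qed

lemma power_of_t_in_ideal_power:
  "laurent (0, int i * D) \<in> (ideal_power (ring_on (mspan S)) max_ideal i :: 'k::field poly poly fract set)"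
proof (induction i)
  case 0
  have "laurent (0, int 0 * D) = (1 :: 'k poly poly fract)" using laurent_0 by (simp add: zero_prod_def)
  then show ?case using one_in_mspan_S by (simp add: ideal_power_def)
next
  case (Suc i)
  interpret ring "ring_on (mspan S :: 'k poly poly fract set)" by (rule ring_mspan_S)
  have "set (gens n r) \<subseteq> (mspan S :: 'k poly poly fract set)"
    using gens_in_mspan mspan_mono[OF S_ge_subset[of 0 1]] by blast
  then have "set (gens n r) \<subseteq> (max_ideal :: 'k poly poly fract set)" using genideal_self by simp
  moreover have "laurent (0, D) \<in> (set (gens n r) :: 'k poly poly fract set)"
    by (auto simp: gens_eq exps_def D_eq)
  ultimately have "laurent (0, D) \<otimes>\<^bsub>ring_on (mspan S)\<^esub> laurent (0, int i * D) \<in>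
      (ideal_prod (ring_on (mspan S)) max_ideal (ideal_power (ring_on (mspan S)) max_ideal i) :: 'k poly poly fract set)"
    using Suc by (intro ideal_prod.prod) auto
  moreover have "laurent (0, D) * laurent (0, int i * D) = (laurent (0, int (Suc i) * D) :: 'k poly poly fract)"
    by (simp add: distrib_right flip: laurent_add)
  ultimately show ?case by (simp add: ideal_power_def)
qed

text \<open>
  The \<open>i\<close>-th power of \<open>t\<^sup>D\<close> carries \<open>exceptional 0\<close> to \<open>exceptional i\<close>, which gives one direction; the
  other one is \<open>S_ge_plus_S'\<close>.
\<close>

lemma annihilation_iff:
  "annihilates_local_cohomology (ideal_power (ring_on (mspan S)) max_ideal i)
     (mspan S :: 'k::field poly poly fract set) (gens n r) 1 \<longleftrightarrow> exceptional i \<in> S"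
proof -
  have sub: "ideal_power (ring_on (mspan S)) max_ideal i \<subseteq> (mspan S :: 'k poly poly fract set)"
    using ideal_power_subset mspan_mono[OF S_ge_subset[of 0 i]] by blast
  show ?thesis
    unfolding annihilates_iff[OF sub]
  proof (intro iffI ballI)
    assume *: "\<forall>a\<in>ideal_power (ring_on (mspan S)) max_ideal i. \<forall>x\<in>mspan S'. a * x \<in> (mspan S :: 'k poly poly fract set)"
    have "laurent (exceptional 0) \<in> mspan S'" by (rule mspan_laurent1[OF exceptional_in_S'])
    then have "laurent (0, int i * D) * laurent (exceptional 0) \<in> (mspan S :: 'k poly poly fract set)"
      using * power_of_t_in_ideal_power by blast
    moreover have "(0, int i * D) + exceptional 0 = exceptional i" by (simp add: exceptional_def)
    ultimately show "exceptional i \<in> S" by (metis laurent_add laurent_in_mspan_iff)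
  next
    fix a x :: "'k poly poly fract"
    assume "exceptional i \<in> S" "a \<in> ideal_power (ring_on (mspan S)) max_ideal i" "x \<in> mspan S'"
    then show "a * x \<in> mspan S"
      using ideal_power_subset by (intro mspan_mult[of a "S_ge i" x S']) (auto intro: S_ge_plus_S')
  qed
qed


lemma grading_zero: "0 \<in> grading n r j"
  by (simp add: grading_def zero_homogeneous)

lemma grading_mspan:
  assumes "x \<in> mspan T" "x \<in> grading n r j"
  shows "x \<in> mspan (T \<inter> degree_set (j * D))"
  using mspan_homogeneous[OF assms(1)] assms(2) by (simp add: grading_def D_eq)

lemma exceptional_homogeneous:
  "laurent (exceptional j) \<in> (grading n r (int (j + 2)) :: 'k::field poly poly fract set)"
proof -
  have "fst (exceptional j) \<ge> 0" "snd (exceptional j) \<ge> 0"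
    using r_bound n_pos D_pos by (auto simp: exceptional_def)
  then have "exceptional j = (int (nat (fst (exceptional j))), int (nat (snd (exceptional j))))"
    by (simp add: prod_eq_iff)
  then have "laurent (exceptional j) =
      (monom_st (nat (fst (exceptional j))) (nat (snd (exceptional j))) :: 'k poly poly fract)"
    by (metis laurent_nat)
  moreover have "int (nat (fst (exceptional j)) + nat (snd (exceptional j))) = int (j + 2) * D"
    using \<open>fst (exceptional j) \<ge> 0\<close> \<open>snd (exceptional j) \<ge> 0\<close> exceptional_degree[of j] by simp
  ultimately show ?thesis
    using monom_st_homogeneous unfolding grading_def D_eq[symmetric] by metis
qed

lemma exceptional_gap:
  assumes "exceptional k \<in> S" "exceptional (k - 1) \<notin> S"
  shows "3 * int r \<notin> sumset 2" "3 * int r + int k * D \<in> sumset (k + 2)"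
proof -
  have "exceptional 0 \<notin> S" using exceptional_mono[of 0 "k - 1"] assms(2) by blast
  then have "3 * int r + int 0 * D \<notin> sumset (0 + 2)" unfolding exceptional_in_S_iff .
  then show "3 * int r \<notin> sumset 2" by (metis add_0 add_0_right mult_zero_left of_nat_0)
  show "3 * int r + int k * D \<in> sumset (k + 2)" using assms(1) unfolding exceptional_in_S_iff .
qed

text \<open>
  The class of \<open>exceptional (k - 1)\<close> is a nonzero element of \<open>H\<^sup>1\<close> of degree \<open>k + 1\<close>. There is nothing
  above it: elements of \<open>S'\<close> of degree at least \<open>k + 2\<close> are in \<open>S\<close>, and \<open>H\<^sup>2\<close> vanishes from degree
  \<open>k + 1\<close> on by \<open>points_of_high_degree\<close>.
\<close>

theorem regularity_eq:
  assumes "exceptional k \<in> S" "exceptional (k - 1) \<notin> S" "k \<ge> 1"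
  shows "regularity (grading n r) (mspan S :: 'k::field poly poly fract set) (gens n r) = int k + 2"
proof -
  interpret surface_cech "mspan S :: 'k poly poly fract set" "gens n r" "mspan G"
    by (rule surface_cech_gens)
  have ends: "loc {0} \<inter> loc {length (gens n r :: 'k poly poly fract list) - 1} = mspan S'"
    unfolding loc_ends mspan_S' ..
  note nonzero_iff = deg_nonzero_iff[of "grading n r", OF grading_zero]
  show ?thesis
    unfolding regularity_def nonzero_iff
  proof (rule Greatest_equality)
    let ?x = "laurent (exceptional (k - 1)) :: 'k poly poly fract"
    have "?x \<in> mspan S'" by (rule mspan_laurent1[OF exceptional_in_S'])
    then have "constant_cochain ?x \<in> cech_cocycles (mspan S) (gens n r) 1"
      using ends by (intro constant_cochain_cocycle) simp
    moreover have "constant_cochain ?x \<notin> cech_coboundaries (mspan S) (gens n r) 1"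
      using assms(2) by (simp only: constant_cochain_coboundary_iff laurent_in_mspan_iff) simp
    moreover have "constant_cochain ?x I \<in> grading n r (int k + 1)" for I
    proof -
      have "int (k - 1 + 2) = int k + 1" using assms(3) by simp
      then have "?x \<in> grading n r (int k + 1)" by (metis exceptional_homogeneous)
      then show ?thesis using grading_zero by (simp only: constant_cochain_def split: if_splits) blast
    qed
    ultimately show "\<exists>p j. int k + 2 = int p + j \<and>
        (\<exists>c\<in>cech_cocycles (mspan S) (gens n r) p. (\<forall>I. (c I :: 'k poly poly fract) \<in> grading n r j) \<and>
          c \<notin> cech_coboundaries (mspan S) (gens n r) p)"
      by (intro exI[of _ 1] exI[of _ "int k + 1"]) auto
  next
    fix d assume "\<exists>p j. d = int p + j \<and>
        (\<exists>c\<in>cech_cocycles (mspan S) (gens n r) p. (\<forall>I. (c I :: 'k poly poly fract) \<in> grading n r j) \<and>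
          c \<notin> cech_coboundaries (mspan S) (gens n r) p)"
    then obtain p j and c :: "nat set \<Rightarrow> 'k poly poly fract" where d: "d = int p + j"
      and c: "c \<in> cech_cocycles (mspan S) (gens n r) p" "\<And>I. c I \<in> grading n r j"
        "c \<notin> cech_coboundaries (mspan S) (gens n r) p"
      by blast
    have "p \<noteq> 0"
    proof
      assume "p = 0"
      then have "c = (\<lambda>_. 0)" using c(1) H0 by simp
      then show False using c(3) coboundaries_zero by simp
    qed
    moreover have "\<not> p \<ge> 3" using H_ge_3_vanishes[OF c(1)] c(3) by blast
    ultimately consider "p = 1" | "p = 2" by linarith
    then show "d \<le> int k + 2"
    proof cases
      case 1
      obtain x where x: "x \<in> loc {0} \<inter> loc {length (gens n r :: 'k poly poly fract list) - 1}" "c = constant_cochain x"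
        using c(1) unfolding 1 by (rule cocycle_1_constant)
      have "x \<in> mspan S'" using x(1) unfolding ends .
      moreover have "x = c {0}" using x(2) by (simp add: constant_cochain_def)
      ultimately have mem: "x \<in> mspan (S' \<inter> degree_set (j * D))" using grading_mspan c(2) by metis
      have "x \<notin> mspan S" using c(3) constant_cochain_coboundary_iff unfolding 1 x(2) by blast
      then have "\<not> S' \<inter> degree_set (j * D) \<subseteq> S" using mem mspan_mono by blast
      then have "\<not> j \<ge> int k + 2"
        using S'_high_degree[OF assms(1), of _ j] by (auto simp: degree_set_def)
      then show ?thesis using d 1 by simp
    next
      case 2
      have sub: "{0, length (gens n r :: 'k poly poly fract list) - 1} \<subseteq> {..<length (gens n r :: 'k poly poly fract list)}"
        by auto
      have "c {0, length (gens n r :: 'k poly poly fract list) - 1} \<in> mspan G"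
        using cochainD(1)[OF cocycleD(1)[OF c(1)] sub] loc_subset[OF sub] unfolding 2 gens_top by auto
      then have mem: "c {0, length (gens n r :: 'k poly poly fract list) - 1} \<in> mspan (G \<inter> degree_set (j * D))"
        using grading_mspan c(2) by blast
      have "\<not> G \<inter> degree_set (j * D) \<subseteq> L\<^sub>X \<union> L\<^sub>Y"
      proof
        assume "G \<inter> degree_set (j * D) \<subseteq> L\<^sub>X \<union> L\<^sub>Y"
        then have "c {0, length (gens n r :: 'k poly poly fract list) - 1} \<in> mspan (L\<^sub>X \<union> L\<^sub>Y)"
          using mem mspan_mono by blast
        then obtain y z where "y \<in> mspan L\<^sub>X" "z \<in> mspan L\<^sub>Y"
            "c {0, length (gens n r :: 'k poly poly fract list) - 1} = y + z"
          unfolding mspan_Un by blast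
        then have "c \<in> cech_coboundaries (mspan S) (gens n r) 2"
          using c(1) unfolding 2 by (intro H2_vanishes) (simp_all only: loc_ends)
        then show False using c(3) 2 by simp
      qed
      then obtain g where g: "g \<in> G \<inter> degree_set (j * D)" "g \<notin> L\<^sub>X \<union> L\<^sub>Y" by blast
      obtain a b where "g = (a, b)" by (cases g)
      then have ab: "a + b = j * D" "(a, b) \<notin> L\<^sub>X \<union> L\<^sub>Y" using g by (simp_all add: degree_set_def)
      have "\<not> j \<ge> int k + 1"
        using points_of_high_degree[OF exceptional_gap[OF assms(1,2)] ab(1)] ab(2) by blast
      then show ?thesis using d 2 by simp
    qed
  qed
qed

section \<open>Homogeneous elements of the Macaulayfication\<close>

text \<open>
  With \<open>z = laurent v\<close>, finite length gives \<open>(z\<^sup>m - z\<^sup>m\<^sup>+\<^sup>1 u) x \<in> K[S]\<close>. As \<open>u\<close> has no components of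
  negative degree, \<open>z\<^sup>m x\<close> is the component of lowest degree of this element, and \<open>K[S]\<close> contains the
  components of its elements. Degrees are compared after multiplication by a denominator \<open>q\<close> of \<open>x\<close>.
\<close>

lemma homogeneous_torsion:
  assumes fl: "finite_length_quotient (mspan S) M (mspan S)" and x: "x \<in> M" "x \<in> grading n r j"
    and v: "v \<in> S" "fst v + snd v = D"
  shows "(x :: 'k::field poly poly fract) \<in> localization_at (mspan S) (laurent v)"
proof -
  let ?z = "laurent v :: 'k poly poly fract"
  have zS: "?z \<in> mspan S" using v(1) by (rule mspan_laurent1)
  obtain m u where u: "u \<in> mspan S" "(?z ^ m - ?z ^ Suc m * u) * x \<in> mspan S"
    using composition_series_absorption[OF one_in_mspan_S mspan_diff S_mspan_mult zS fl x(1)] by blast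
  obtain p q e where pq: "p \<in> mspan (degree_set (e + j * D))" "q \<in> mspan (degree_set e)" "q \<noteq> 0" "x * q = p"
    using x(2) unfolding grading_def D_eq[symmetric] by (rule homogeneous_partE)
  define d where "d = j * D + int m * D"
  obtain h h' where h: "(?z ^ m - ?z ^ Suc m * u) * x = h + h'" "h \<in> mspan (S \<inter> degree_set d)" "h' \<in> mspan (S - degree_set d)"
    using u(2) by (rule mspan_split)
  have zp: "?z ^ i \<in> mspan (degree_set (int i * D))" for i
    unfolding laurent_power
    by (rule mspan_laurent1) (simp add: degree_set_def v(2)[symmetric] distrib_left)
  have "?z ^ m * p - q * h \<in> mspan (degree_set (e + d))"
  proof (rule mspan_diff)
    show "?z ^ m * p \<in> mspan (degree_set (e + d))"
      using zp pq(1) by (rule mspan_mult) (simp add: degree_set_def d_def)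
    show "q * h \<in> mspan (degree_set (e + d))"
      using pq(2) h(2) by (rule mspan_mult) (simp add: degree_set_def)
  qed
  moreover have "?z ^ m * p - q * h = q * h' + ?z ^ Suc m * (u * p)"
    using arg_cong[OF h(1), of "\<lambda>y. y * q"] pq(4)[symmetric] by (simp add: algebra_simps)
  moreover have "q * h' + ?z ^ Suc m * (u * p) \<in> mspan (- degree_set (e + d))"
  proof (rule mspan_add)
    show "q * h' \<in> mspan (- degree_set (e + d))"
      using pq(2) h(3) by (rule mspan_mult) (simp add: degree_set_def)
    have "u * p \<in> mspan {g. fst g + snd g \<ge> e + j * D}"
      using u(1) pq(1)
    proof (rule mspan_mult)
      fix g h assume "g \<in> S" "h \<in> degree_set (e + j * D)"
      moreover from \<open>g \<in> S\<close> obtain d where "fst g + snd g = int d * D" using S_degree by blast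
      then have "fst g + snd g \<ge> 0" using D_pos by simp
      ultimately show "g + h \<in> {g. fst g + snd g \<ge> e + j * D}"
        by (simp add: degree_set_def)
    qed
    with zp[of "Suc m"] show "?z ^ Suc m * (u * p) \<in> mspan (- degree_set (e + d))"
      by (rule mspan_mult) (use D_pos in \<open>auto simp: degree_set_def d_def algebra_simps\<close>)
  qed
  ultimately have "?z ^ m * p - q * h = 0" by (metis mspan_disjoint Compl_disjoint)
  then have "q * (?z ^ m * x - h) = 0" unfolding pq(4)[symmetric] by (simp add: right_diff_distrib mult_ac)
  then have "?z ^ m * x = h" using pq(3) by simp
  moreover have "?z ^ m \<noteq> 0" using laurent_nonzero by (rule power_not_zero)
  ultimately have "x = h / ?z ^ m" by (metis nonzero_mult_div_cancel_left)
  moreover have "h \<in> mspan S" using h(2) mspan_mono[of "S \<inter> degree_set d" S] by blast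
  ultimately show ?thesis unfolding localization_at_def by blast
qed

lemma Q_gens_eq: "Q_gens n r = {laurent (D, 0), laurent (0, D) :: 'k::field poly poly fract}"
proof -
  have "monom_st (a_exp r n) 0 = (laurent (D, 0) :: 'k poly poly fract)"
    "monom_st 0 (a_exp r n) = (laurent (0, D) :: 'k poly poly fract)"
    unfolding D_eq by (simp_all flip: laurent_nat)
  then show ?thesis by (simp add: Q_gens_def)
qed

text \<open>
  A point of \<open>S'\<close> of degree \<open>k + 3\<close>, moved by \<open>(- D, - D)\<close>, has degree \<open>k + 1\<close> and lies in \<open>L\<^sub>X \<union> L\<^sub>Y\<close>.
  Undoing one of the two shifts gives a point of \<open>S'\<close> of degree \<open>k + 2\<close>, hence of \<open>S\<close>. So each
  monomial of degree \<open>k + 3\<close> is a multiple of \<open>s\<^sup>D\<close> or \<open>t\<^sup>D\<close> with cofactor in \<open>K[S]\<close>.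
\<close>

theorem reduction_number_le:
  assumes k: "exceptional k \<in> S" "exceptional (k - 1) \<notin> S" "k \<ge> 1"
    and sub: "subring M (ring_of_type_algebra :: 'k::field poly poly fract ring)" "mspan S \<subseteq> M"
    and fl: "finite_length_quotient (mspan S) M (mspan S)"
  shows "reduction_number (grading n r) (Q_gens n r) M \<le> k + 2"
  unfolding reduction_number_def
proof (rule Least_le)
  interpret ring "ring_on M" by (rule ring_on_ring[OF sub(1)])
  let ?X = "laurent (D, 0) :: 'k poly poly fract" and ?Y = "laurent (0, D) :: 'k poly poly fract"
  have XY: "(D, 0) \<in> S" "(0, D) \<in> S"
    using gen_in_S[of 0] gen_in_S[of "a_exp r n"] S_ge_subset[of 0 1] by (auto simp: exps_def D_eq)
  then have "?X \<in> M" "?Y \<in> M" using sub(2) mspan_laurent1 by blast+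
  then have Q: "Q_gens n r \<subseteq> carrier (ring_on M)" by (simp add: Q_gens_eq)
  have I: "ideal (Idl\<^bsub>ring_on M\<^esub> (Q_gens n r)) (ring_on M)" by (rule genideal_ideal[OF Q])
  have inQ: "?X \<in> Idl\<^bsub>ring_on M\<^esub> (Q_gens n r)" "?Y \<in> Idl\<^bsub>ring_on M\<^esub> (Q_gens n r)"
    using genideal_self[OF Q] by (auto simp: Q_gens_eq)
  have "x \<in> Idl\<^bsub>ring_on M\<^esub> (Q_gens n r)" if x: "x \<in> M" "x \<in> grading n r (int (k + 2) + 1)" for x
  proof -
    have "x \<in> mspan L\<^sub>X" "x \<in> mspan L\<^sub>Y"
      using homogeneous_torsion[OF fl x] XY unfolding loc_X[symmetric] loc_Y[symmetric] by auto
    then have "x \<in> mspan S'" by (simp add: mspan_S')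
    from grading_mspan[OF this x(2)] have mem: "x \<in> mspan (S' \<inter> degree_set ((int (k + 2) + 1) * D))" .
    have "S' \<inter> degree_set ((int (k + 2) + 1) * D) \<subseteq> (+) (D, 0) ` S \<union> (+) (0, D) ` S"
    proof safe
      fix a b assume ab: "(a, b) \<in> S'" "(a, b) \<in> degree_set ((int (k + 2) + 1) * D)" "(a, b) \<notin> (+) (0, D) ` S"
      have sum: "a + b = (int k + 3) * D" using ab(2) by (simp add: degree_set_def)
      then have "(a - D) + (b - D) = (int k + 1) * D" by (simp add: algebra_simps)
      then have low: "(a - D, b - D) \<in> L\<^sub>X \<union> L\<^sub>Y"
        by (rule points_of_high_degree[OF exceptional_gap[OF k(1,2)]]) simp
      have G: "(a - D, b) \<in> G" "(a, b - D) \<in> G"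
        using sum by (auto simp: G_def algebra_simps)
      have high: "(a', b') \<in> S" if "(a', b') \<in> S'" "a' + b' = (int k + 2) * D" for a' b'
        using S'_high_degree[OF k(1) that(1), of "int k + 2"] that(2) by simp
      have "(a, b - D) \<notin> S" using ab(3) by force
      moreover have "a + (b - D) = (int k + 2) * D" "(a - D) + b = (int k + 2) * D"
        using sum by (auto simp: algebra_simps)
      ultimately have "(a, b - D) \<notin> S'" "(a - D, b) \<in> S' \<Longrightarrow> (a - D, b) \<in> S" using high by blast+
      moreover have "(a, b - D) \<in> S' \<or> (a - D, b) \<in> S'"
        using low ab(1) G by (auto simp: S'_iff L\<^sub>X_def L\<^sub>Y_def)
      ultimately have "(a - D, b) \<in> S" by blast
      then show "(a, b) \<in> (+) (D, 0) ` S" by (intro image_eqI[of _ _ "(a - D, b)"]) auto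
    qed
    then have "x \<in> mspan ((+) (D, 0) ` S \<union> (+) (0, D) ` S)" using mem mspan_mono by blast
    then obtain y z where yz: "y \<in> mspan ((+) (D, 0) ` S)" "z \<in> mspan ((+) (0, D) ` S)" "x = y + z"
      unfolding mspan_Un by blast
    obtain y' where y': "y' \<in> mspan S" "y = ?X * y'" using mspan_translateE[OF yz(1)] .
    obtain z' where z': "z' \<in> mspan S" "z = ?Y * z'" using mspan_translateE[OF yz(2)] .
    have "y \<in> Idl\<^bsub>ring_on M\<^esub> (Q_gens n r)" "z \<in> Idl\<^bsub>ring_on M\<^esub> (Q_gens n r)"
      using ideal.I_r_closed[OF I inQ(1), of y'] ideal.I_r_closed[OF I inQ(2), of z'] y' z' sub(2) by auto
    then have "y \<oplus>\<^bsub>ring_on M\<^esub> z \<in> Idl\<^bsub>ring_on M\<^esub> (Q_gens n r)"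
      by (rule additive_subgroup.a_closed[OF ideal.axioms(1)[OF I]])
    then show ?thesis by (simp add: yz(3))
  qed
  moreover have "Idl\<^bsub>ring_on M\<^esub> (Q_gens n r) \<subseteq> M" using ideal.Icarr[OF I] by auto
  ultimately show "M \<inter> grading n r (int (k + 2) + 1) =
      Idl\<^bsub>ring_on M\<^esub> (Q_gens n r) \<inter> grading n r (int (k + 2) + 1)"
    by blast
qed

end

theorem corollary5p4:
  fixes n r k :: nat
    and R Rt :: "'k::field poly poly fract set"
  assumes "n \<ge> 1" and "r \<ge> 5" and "k \<ge> 1"
    and "R = monomial_ring n r"
    and "strictly_buchsbaum k R (gens n r)"
    and "is_macaulayfication R Rt"
  shows "regularity (grading n r) R (gens n r)
           = max (int k + 2) (int (reduction_number (grading n r) (Q_gens n r) Rt))"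
proof -
  interpret two_parameters n r using assms(1,2) by unfold_locales
  have R: "R = mspan S" using assms(4) monomial_ring_eq by simp
  have k: "exceptional k \<in> S" "exceptional (k - 1) \<notin> S"
    using assms(5) annihilation_iff unfolding R strictly_buchsbaum_def Let_def by blast+
  have "subring Rt ring_of_type_algebra" "mspan S \<subseteq> Rt" "finite_length_quotient (mspan S) Rt (mspan S)"
    using assms(6) unfolding R is_macaulayfication_def finite_extension_def by auto
  then have "reduction_number (grading n r) (Q_gens n r) Rt \<le> k + 2"
    by (rule reduction_number_le[OF k assms(3)])
  moreover have "regularity (grading n r) R (gens n r) = int k + 2"
    unfolding R by (rule regularity_eq[OF k assms(3)])
  ultimately show ?thesis by simp
qed

end
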